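(* Let $n\ge 4$ and let $\Gamma$ be a type I quiver of mutation type $D_n$, labelled by the type I labelling procedure. Let $\Phi$ be the root system of type $D_n$ with simple system $\Pi=\{\alpha_1,\ldots,\alpha_n\}$, and identify vertices with their labels. Then the set $\{\beta_i : i\in\Gamma_0\}\subseteq\Phi$ given by $$\beta_i=\begin{cases}\alpha_i+\ldots+\alpha_{i+a} & \text{if } i \text{ is a primary vertex and } i+a \text{ is the complementary vertex corresponding to } i,\\ \alpha_i & \text{if } i \text{ is not a primary vertex}\end{cases}$$ is a companion basis for $\Gamma$.
   Context: **Mutation type.** For a simply-laced Dynkin diagram $\Delta$, a quiver is of mutation type $\Delta$ if it is obtained by a finite sequence of (Fomin--Zelevinsky) quiver mutations from a quiver whose underlying graph is $\Delta$. $\Gamma_0$ denotes the vertex set of $\Gamma$. **Root system.** $\Phi$ is the root system of type $D_n$, with inner product $(\cdot,\cdot)$ normalized so that $(\alpha,\alpha)=2$ for all roots $\alpha$; the simple roots are numbered so that the Dynkin diagram is the chain $1 - 2 - \cdots - (n-2)$ with $n-2$ additionally joined to both $n-1$ and $n$. **Companion basis.** A companion basis for a quiver $\Gamma$ of mutation type $\Delta$ is a subset $\{\gamma_x : x\in\Gamma_0\}\subseteq\Phi$ (with $\Phi$ the root system of type $\Delta$) whose elements form a $\mathbb{Z}$-basis of the root lattice $\mathbb{Z}\Phi$ and such that for all distinct $x,y\in\Gamma_0$, $|(\gamma_x,\gamma_y)|$ equals the number of edges joining $x$ and $y$ in the underlying unoriented graph of $\Gamma$. **Structure of type $A$ quivers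 (known facts making the definitions below meaningful).** A quiver $Q$ of mutation type $A_k$ is connected; the only cycles in its underlying graph are 3-cycles, each of which is cyclically oriented in $Q$; every vertex has valency at most four and lies on at most two 3-cycles. An end vertex is a vertex that has valency zero, or valency one, or has valency two and belongs to a cyclically oriented 3-cycle; if $k\ge 2$ there are at least two end vertices. A string in $Q$ is a reduced walk in $Q$ that does not contain two consecutive arrows of any given 3-cycle; for any two vertices $i,j$ there is a unique string from $i$ to $j$ (trivial if $i=j$), and it visits no vertex twice. Let $p$ be a string from $i$ to $j$. For a 3-cycle with two vertices appearing in $p$, the first of these met when moving along $p$ from $i$ to $j$ is a primary vertex relative to $p$, the second is the secondary vertex corresponding to it relative to $p$, and the vertex of the 3-cycle not on $p$ is the complementary vertex corresponding to it relative to $p$. If $x,y,z$ are the vertices of a 3-cycle, the subquiver of $Q$ rooted at $x$ is the full subquiver on all vertices that can be reached on strings starting at $x$ which do not pass through $y$ or $z$; it is again a quiver of mutation type $A$, and $x$ is an end vertex of it. **Type $A$ labelling procedure.** The input is a quiver $Q$ of mutation type $A_k$ and an ordered pair of end vertices of $Q$, distinct if $k\ge 2$. If $k=1$, label the vertex $1$. If $k\ge 2$ with pair $(e,f)$, label $e$ by $1$ and let $p$ be the string from $e$ to $f$; move along $p$ from $e$ to $f$. If the current vertex has label $\ell$ and is not a primary vertex relative to $p$, label the next vertex of $p$ by $\ell+1$. If the current vertex has label $\ell$ and is a primary vertex relative to $p$ with corresponding complementary vertex $z$, let $Q'$ be the subquiver of $Q$ rooted at $z$ and let $a$ be its number of vertices;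 choose an end vertex $z'$ of $Q'$, distinct from $z$ if $a>1$; recursively label $Q'$ with $1,\ldots,a$ using the ordered pair $(z',z)$; add $\ell$ to each of these labels and assign the results to the corresponding vertices of $Q$; then label the next vertex on $p$ (the corresponding secondary vertex) by $\ell+a+1$. Continue until $f$ is labelled; it gets the label $k$. **Type I quivers.** Let $\Gamma^{(0)}$ be the quiver with three vertices $a,b,c_1$ and exactly two arrows, one joining $c_1$ and $a$ and one joining $c_1$ and $b$, each with arbitrary orientation. $\Gamma$ is of type I if it is obtained from a disjoint union $\Gamma^{(0)}\sqcup\Gamma^{(1)}$, where $\Gamma^{(1)}$ is a quiver of mutation type $A_{n-2}$, by identifying some end vertex $v_1$ of $\Gamma^{(1)}$ with $c_1$. **Labelling of a type I quiver.** Choose an ordered pair of distinct end vertices of $\Gamma^{(1)}$ with $v_1$ the second vertex in the pair, apply the type $A$ labelling procedure to $\Gamma^{(1)}$ with this pair (so $v_1$ gets label $n-2$), and use these labels in $\Gamma$. Label the remaining two vertices $a,b$ of $\Gamma$ by $n-1$ and $n$. **Vertex types in the labelled quiver.** If the vertices of a 3-cycle of $\Gamma^{(1)}$ have labels $i<j<k$, then $i$ is called a primary vertex, $j$ a complementary vertex (the complementary vertex corresponding to $i$), and $k$ a secondary vertex. A vertex of $\Gamma$ is primary (resp. complementary, secondary) if it is so in $\Gamma^{(1)}$. *)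

theory Defs
  imports "HOL-Analysis.Analysis"
begin

section \<open>Quivers and mutation\<close>

text \<open>
  A quiver is recorded by its vertex set and by the number of arrows from one vertex to another.
  All quivers to be mutated are finite and have no loops and no oriented 2-cycles.
\<close>

record 'v quiver =
  verts :: "'v set"
  arr :: "'v \<Rightarrow> 'v \<Rightarrow> nat"

definition is_quiver :: "'v quiver \<Rightarrow> bool" where
  "is_quiver Q \<longleftrightarrow>
     finite (verts Q) \<and>
     (\<forall>x y. arr Q x y > 0 \<longrightarrow> x \<in> verts Q \<and> y \<in> verts Q) \<and>
     (\<forall>x. arr Q x x = 0) \<and>
     (\<forall>x y. arr Q x y = 0 \<or> arr Q y x = 0)"

definition edges :: "'v quiver \<Rightarrow> 'v \<Rightarrow> 'v \<Rightarrow> nat" where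
  "edges Q x y = arr Q x y + arr Q y x"

text \<open>
  Fomin--Zelevinsky mutation at \<open>k\<close>: add an arrow \<open>i \<rightarrow> j\<close> for every path \<open>i \<rightarrow> k \<rightarrow> j\<close>, reverse
  the arrows at \<open>k\<close>, and cancel a maximal set of 2-cycles; truncated subtraction on the naturals
  performs the cancellation.
\<close>

definition mutate :: "'v \<Rightarrow> 'v quiver \<Rightarrow> 'v quiver" where
  "mutate k Q = \<lparr>verts = verts Q,
     arr = (\<lambda>i j. if i = k \<or> j = k then arr Q j i
                  else (arr Q i j + arr Q i k * arr Q k j)
                     - (arr Q j i + arr Q j k * arr Q k i))\<rparr>"

definition mutation_step :: "'v quiver \<Rightarrow> 'v quiver \<Rightarrow> bool" where
  "mutation_step Q Q' \<longleftrightarrow> (\<exists>k \<in> verts Q. Q' = mutate k Q)"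

text \<open>A simply-laced Dynkin diagram of rank \<open>N\<close> is given by its set of edges on \<open>{1..N}\<close>.\<close>

definition dynkin_A :: "nat \<Rightarrow> nat set set" where
  "dynkin_A k = {{i, Suc i} | i. 1 \<le> i \<and> i < k}"

definition dynkin_D :: "nat \<Rightarrow> nat set set" where
  "dynkin_D n = {{i, Suc i} | i. 1 \<le> i \<and> i < n - 2} \<union> {{n - 2, n - 1}, {n - 2, n}}"

definition underlying_graph_is :: "nat \<Rightarrow> nat set set \<Rightarrow> 'v quiver \<Rightarrow> bool" where
  "underlying_graph_is N E Q \<longleftrightarrow>
     (\<exists>f. bij_betw f {1..N} (verts Q) \<and>
          (\<forall>i \<in> {1..N}. \<forall>j \<in> {1..N}. edges Q (f i) (f j) = (if {i, j} \<in> E then 1 else 0)))"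

definition mutation_type :: "nat \<Rightarrow> nat set set \<Rightarrow> 'v quiver \<Rightarrow> bool" where
  "mutation_type N E Q \<longleftrightarrow>
     (\<exists>Q0. is_quiver Q0 \<and> underlying_graph_is N E Q0 \<and> mutation_step\<^sup>*\<^sup>* Q0 Q)"


section \<open>Root systems and companion bases\<close>

definition cartan_number :: "'e::real_inner \<Rightarrow> 'e \<Rightarrow> real" where
  "cartan_number \<beta> \<alpha> = 2 * (\<beta> \<bullet> \<alpha>) / (\<alpha> \<bullet> \<alpha>)"

text \<open>A reduced crystallographic root system in the Euclidean space \<^term>\<open>span \<Phi>\<close>.\<close>

definition root_system :: "'e::real_inner set \<Rightarrow> bool" where
  "root_system \<Phi> \<longleftrightarrow>
     finite \<Phi> \<and> 0 \<notin> \<Phi> \<and>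
     (\<forall>\<alpha> \<in> \<Phi>. \<forall>c. c *\<^sub>R \<alpha> \<in> \<Phi> \<longleftrightarrow> c = 1 \<or> c = - 1) \<and>
     (\<forall>\<alpha> \<in> \<Phi>. \<forall>\<beta> \<in> \<Phi>. \<beta> - cartan_number \<beta> \<alpha> *\<^sub>R \<alpha> \<in> \<Phi>) \<and>
     (\<forall>\<alpha> \<in> \<Phi>. \<forall>\<beta> \<in> \<Phi>. cartan_number \<beta> \<alpha> \<in> \<int>)"

definition simple_system :: "nat \<Rightarrow> (nat \<Rightarrow> 'e::real_inner) \<Rightarrow> 'e set \<Rightarrow> bool" where
  "simple_system N \<alpha> \<Phi> \<longleftrightarrow>
     \<alpha> ` {1..N} \<subseteq> \<Phi> \<and> inj_on \<alpha> {1..N} \<and> independent (\<alpha> ` {1..N}) \<and>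
     (\<forall>\<beta> \<in> \<Phi>. \<exists>c :: nat \<Rightarrow> int.
        \<beta> = (\<Sum>i = 1..N. of_int (c i) *\<^sub>R \<alpha> i) \<and>
        ((\<forall>i \<in> {1..N}. c i \<ge> 0) \<or> (\<forall>i \<in> {1..N}. c i \<le> 0)))"

text \<open>
  \<open>\<Phi>\<close> is a root system whose Dynkin diagram, with respect to the numbered simple roots
  \<open>\<alpha> 1, \<dots>, \<alpha> N\<close>, is the simply-laced diagram \<open>E\<close>; all roots are normalized to square length 2.
\<close>

definition root_system_of_type ::
    "nat \<Rightarrow> nat set set \<Rightarrow> (nat \<Rightarrow> 'e::real_inner) \<Rightarrow> 'e set \<Rightarrow> bool" where
  "root_system_of_type N E \<alpha> \<Phi> \<longleftrightarrow>
     root_system \<Phi> \<and> (\<forall>\<beta> \<in> \<Phi>. \<beta> \<bullet> \<beta> = 2) \<and> simple_system N \<alpha> \<Phi> \<and>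
     (\<forall>i \<in> {1..N}. \<forall>j \<in> {1..N}. i \<noteq> j \<longrightarrow>
        cartan_number (\<alpha> i) (\<alpha> j) = (if {i, j} \<in> E then - 1 else 0))"

interpretation int_mod: module "\<lambda>(k::int) (v::'e::real_vector). of_int k *\<^sub>R v"
  by standard (simp_all add: algebra_simps)

text \<open>
  \<^term>\<open>int_mod.span \<Phi>\<close> is the root lattice. A basis is indexed by the vertices, so distinct
  vertices are required to give distinct elements.
\<close>

definition companion_basis ::
    "'e::real_inner set \<Rightarrow> 'v quiver \<Rightarrow> ('v \<Rightarrow> 'e) \<Rightarrow> bool" where
  "companion_basis \<Phi> Q \<gamma> \<longleftrightarrow>
     \<gamma> ` verts Q \<subseteq> \<Phi> \<and>
     inj_on \<gamma> (verts Q) \<and>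
     int_mod.independent (\<gamma> ` verts Q) \<and>
     int_mod.span (\<gamma> ` verts Q) = int_mod.span \<Phi> \<and>
     (\<forall>x \<in> verts Q. \<forall>y \<in> verts Q. x \<noteq> y \<longrightarrow> \<bar>\<gamma> x \<bullet> \<gamma> y\<bar> = real (edges Q x y))"


section \<open>Strings and the labelling procedure for quivers of mutation type A\<close>

definition three_cycles :: "'v quiver \<Rightarrow> 'v set set" where
  "three_cycles Q = {{x, y, z} | x y z. arr Q x y > 0 \<and> arr Q y z > 0 \<and> arr Q z x > 0}"

definition valency :: "'v quiver \<Rightarrow> 'v \<Rightarrow> nat" where
  "valency Q x = (\<Sum>y \<in> verts Q. edges Q x y)"

definition end_vertex :: "'v quiver \<Rightarrow> 'v \<Rightarrow> bool" where
  "end_vertex Q x \<longleftrightarrow> x \<in> verts Q \<and>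
     (valency Q x = 0 \<or> valency Q x = 1 \<or>
      valency Q x = 2 \<and> (\<exists>C \<in> three_cycles Q. x \<in> C))"

text \<open>
  A quiver of mutation type A has no multiple arrows, so a walk (which may traverse arrows in
  either direction) is determined by its list of vertices, and it is reduced iff it never returns
  at once to the vertex it has just left.
\<close>

definition string_from_to :: "'v quiver \<Rightarrow> 'v \<Rightarrow> 'v \<Rightarrow> 'v list \<Rightarrow> bool" where
  "string_from_to Q i j p \<longleftrightarrow>
     p \<noteq> [] \<and> hd p = i \<and> last p = j \<and> set p \<subseteq> verts Q \<and>
     (\<forall>m. Suc m < length p \<longrightarrow> edges Q (p ! m) (p ! Suc m) > 0) \<and>
     (\<forall>m. Suc (Suc m) < length p \<longrightarrow>
        p ! m \<noteq> p ! Suc (Suc m) \<and>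
        {p ! m, p ! Suc m, p ! Suc (Suc m)} \<notin> three_cycles Q)"

text \<open>
  Relative to the string \<open>p\<close>, \<open>x\<close> is a primary vertex with corresponding complementary vertex \<open>z\<close>
  and corresponding secondary vertex \<open>y\<close>.
\<close>

definition pcs_rel :: "'v quiver \<Rightarrow> 'v list \<Rightarrow> 'v \<Rightarrow> 'v \<Rightarrow> 'v \<Rightarrow> bool" where
  "pcs_rel Q p x z y \<longleftrightarrow>
     {x, y, z} \<in> three_cycles Q \<and> z \<notin> set p \<and>
     (\<exists>i j. i < j \<and> j < length p \<and> p ! i = x \<and> p ! j = y)"

definition full_subquiver :: "'v quiver \<Rightarrow> 'v set \<Rightarrow> 'v quiver" where
  "full_subquiver Q W = \<lparr>verts = W,
     arr = (\<lambda>x y. if x \<in> W \<and> y \<in> W then arr Q x y else 0)\<rparr>"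

text \<open>The subquiver rooted at \<open>x\<close>, where \<open>x, y, z\<close> are the vertices of a 3-cycle.\<close>

definition rooted_subquiver :: "'v quiver \<Rightarrow> 'v \<Rightarrow> 'v \<Rightarrow> 'v \<Rightarrow> 'v quiver" where
  "rooted_subquiver Q x y z =
     full_subquiver Q {w. \<exists>p. string_from_to Q x w p \<and> y \<notin> set p \<and> z \<notin> set p}"

text \<open>
  \<^term>\<open>type_A_labelling Q e f L\<close>: some run of the (non-deterministic) labelling procedure on \<open>Q\<close>
  with ordered pair \<open>(e, f)\<close> assigns the label \<open>L v\<close> to every vertex \<open>v\<close>. The procedure assigns
  each label once, so a run is described by the assignments it makes. Values of \<open>L\<close> outside
  \<^term>\<open>verts Q\<close> are irrelevant.
\<close>

inductive type_A_labelling :: "'v quiver \<Rightarrow> 'v \<Rightarrow> 'v \<Rightarrow> ('v \<Rightarrow> nat) \<Rightarrow> bool" where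
  single: "verts Q = {v} \<Longrightarrow> L v = 1 \<Longrightarrow> type_A_labelling Q v v L"
| string: "finite (verts Q) \<Longrightarrow> card (verts Q) \<ge> 2 \<Longrightarrow>
    end_vertex Q e \<Longrightarrow> end_vertex Q f \<Longrightarrow> e \<noteq> f \<Longrightarrow>
    string_from_to Q e f p \<Longrightarrow>
    L e = 1 \<Longrightarrow>
    (\<forall>m. Suc m < length p \<longrightarrow> (\<nexists>z y. pcs_rel Q p (p ! m) z y) \<longrightarrow>
        L (p ! Suc m) = L (p ! m) + 1) \<Longrightarrow>
    (\<forall>m z y. Suc m < length p \<longrightarrow> pcs_rel Q p (p ! m) z y \<longrightarrow>
        (\<exists>z' L'.
           end_vertex (rooted_subquiver Q z (p ! m) y) z' \<and>
           (card (verts (rooted_subquiver Q z (p ! m) y)) > 1 \<longrightarrow> z' \<noteq> z) \<and>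
           type_A_labelling (rooted_subquiver Q z (p ! m) y) z' z L' \<and>
           (\<forall>v \<in> verts (rooted_subquiver Q z (p ! m) y). L v = L (p ! m) + L' v)) \<and>
        L (p ! Suc m) = L (p ! m) + card (verts (rooted_subquiver Q z (p ! m) y)) + 1) \<Longrightarrow>
    type_A_labelling Q e f L"


section \<open>Quivers of type I\<close>

definition type_I_core :: "'v \<Rightarrow> 'v \<Rightarrow> 'v \<Rightarrow> 'v quiver \<Rightarrow> bool" where
  "type_I_core a b c Q \<longleftrightarrow>
     is_quiver Q \<and> distinct [a, b, c] \<and> verts Q = {a, b, c} \<and>
     edges Q c a = 1 \<and> edges Q c b = 1 \<and> edges Q a b = 0"

text \<open>Gluing of two quivers along the vertices they have in common.\<close>

definition glue :: "'v quiver \<Rightarrow> 'v quiver \<Rightarrow> 'v quiver" where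
  "glue Q Q' = \<lparr>verts = verts Q \<union> verts Q', arr = (\<lambda>x y. arr Q x y + arr Q' x y)\<rparr>"

text \<open>
  \<open>\<Gamma>\<close> is of type I, obtained from \<open>\<Gamma>1\<close> and the core on \<open>a, b, c\<^sub>1\<close> by identifying the end
  vertex \<open>v1\<close> of \<open>\<Gamma>1\<close> with \<open>c\<^sub>1\<close>. The identified vertex is called \<open>v1\<close> in both quivers.
\<close>

definition type_I_quiver ::
    "nat \<Rightarrow> 'v quiver \<Rightarrow> 'v quiver \<Rightarrow> 'v \<Rightarrow> 'v \<Rightarrow> 'v \<Rightarrow> bool" where
  "type_I_quiver n \<Gamma> \<Gamma>1 v1 a b \<longleftrightarrow>
     mutation_type (n - 2) (dynkin_A (n - 2)) \<Gamma>1 \<and> end_vertex \<Gamma>1 v1 \<and>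
     (\<exists>\<Gamma>0. type_I_core a b v1 \<Gamma>0 \<and> verts \<Gamma>0 \<inter> verts \<Gamma>1 = {v1} \<and> \<Gamma> = glue \<Gamma>0 \<Gamma>1)"

definition type_I_labelling ::
    "nat \<Rightarrow> 'v quiver \<Rightarrow> 'v \<Rightarrow> 'v \<Rightarrow> 'v \<Rightarrow> ('v \<Rightarrow> nat) \<Rightarrow> bool" where
  "type_I_labelling n \<Gamma>1 v1 a b L \<longleftrightarrow>
     (\<exists>e. end_vertex \<Gamma>1 e \<and> e \<noteq> v1 \<and> type_A_labelling \<Gamma>1 e v1 L) \<and>
     (L a = n - 1 \<and> L b = n \<or> L a = n \<and> L b = n - 1)"

text \<open>\<open>x\<close> is a primary vertex and \<open>z\<close> the complementary vertex corresponding to it.\<close>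

definition complementary_to :: "'v quiver \<Rightarrow> ('v \<Rightarrow> nat) \<Rightarrow> 'v \<Rightarrow> 'v \<Rightarrow> bool" where
  "complementary_to \<Gamma>1 L x z \<longleftrightarrow> (\<exists>y. {x, z, y} \<in> three_cycles \<Gamma>1 \<and> L x < L z \<and> L z < L y)"

definition primary_vertex :: "'v quiver \<Rightarrow> ('v \<Rightarrow> nat) \<Rightarrow> 'v \<Rightarrow> bool" where
  "primary_vertex \<Gamma>1 L x \<longleftrightarrow> (\<exists>z. complementary_to \<Gamma>1 L x z)"

definition beta :: "(nat \<Rightarrow> 'e::real_inner) \<Rightarrow> 'v quiver \<Rightarrow> ('v \<Rightarrow> nat) \<Rightarrow> 'v \<Rightarrow> 'e" where
  "beta \<alpha> \<Gamma>1 L x =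
     (if primary_vertex \<Gamma>1 L x
      then \<Sum>j = L x..L (THE z. complementary_to \<Gamma>1 L x z). \<alpha> j
      else \<alpha> (L x))"

end

theory Submission
  imports Defs
begin

text \<open>
  A quiver of mutation type A is a tree of edges and oriented triangles. It can be cut at any vertex
  into two branches, each attached to the vertex by nothing, an edge, or a triangle, and mutation at
  the vertex merely regroups the sub-branches. At an end vertex one of the two branches is trivial,
  so a run of the labelling procedure can be followed by induction on the branch rooted at the last
  vertex of the pair, the complementary sub-branches being labelled recursively.

  In coordinates, \<open>\<beta>\<^bsub>x\<^esub> = \<epsilon>\<^bsub>i\<^esub> - \<epsilon>\<^bsub>c\<^esub>\<close> where \<open>i\<close> is the label of \<open>x\<close>, and the procedure guarantees that
  two vertices of the type A part are adjacent iff their roots share an index. As \<open>\<beta>\<^bsub>x\<^esub>\<close> is \<open>\<alpha>\<^bsub>i\<^esub>\<close> plus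
  simple roots of larger index, these roots form a basis of the root lattice.
\<close>

section \<open>Branches of quivers of mutation type A\<close>

text \<open>Mutation at \<open>k\<close> is transparent only for a cut at \<open>k\<close> itself.
  The invariant therefore asks for a cut at every vertex, and proving one cut is enough because it
  can be carried from vertex to vertex. Sub-branches are filed by the direction of their arrow,
  since the orientation of a triangle then fixes which arrows mutation cancels or creates.

  The index criterion survives the procedure because of an asymmetry. In a block with labels l+1,
  ..., l+m only the root of the vertex labelled l+m uses the index l+m+1; the roots of all others
  stay within l+1, ..., l+m. That last vertex is the root of the branch, the only vertex of the
  block with edges leading out of it. At a triangle y, z, f with z complementary, the roots of y and
  z both end at the label of f, where the root of f starts, so one shared index produces all three
  edges.

  The same asymmetry governs the fork of the Dynkin diagram: only the root of \<open>v1\<close> ends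
  at n-1, so \<open>v1\<close> alone is joined to the two remaining vertices.\<close>

lemma edges_sym: "edges Q x y = edges Q y x"
  by (simp add: edges_def)

lemma three_cycles_edges:
  assumes "C \<in> three_cycles Q" "u \<in> C" "v \<in> C" "u \<noteq> v"
  shows "edges Q u v > 0"
  using assms unfolding three_cycles_def edges_def by auto

text \<open>Below, \<open>Y\<close> and \<open>Z\<close> are empty or contain just the root of \<open>A\<close> resp. \<open>B\<close>: the arrows at \<open>x\<close> go
  to the root of \<open>A\<close> and come from the root of \<open>B\<close>, and if both roots exist they complete a 3-cycle.\<close>

definition joined :: "'v quiver \<Rightarrow> 'v \<Rightarrow> 'v set \<Rightarrow> 'v set \<Rightarrow> 'v set \<Rightarrow> 'v set \<Rightarrow> bool" where
  "joined Q x Y A Z B \<longleftrightarrow>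
     x \<notin> A \<and> x \<notin> B \<and> A \<inter> B = {} \<and> arr Q x x = 0 \<and>
     (\<forall>w\<in>A. arr Q x w = of_bool (w \<in> Y) \<and> arr Q w x = 0) \<and>
     (\<forall>w\<in>B. arr Q w x = of_bool (w \<in> Z) \<and> arr Q x w = 0) \<and>
     (\<forall>u\<in>A. \<forall>w\<in>B. arr Q u w = of_bool (u \<in> Y \<and> w \<in> Z) \<and> arr Q w u = 0)"

text \<open>Allowing empty root sets folds the leaf, the edge in either direction and the oriented
  triangle into a single constructor, so every induction has one essential case.\<close>

inductive branch :: "'v quiver \<Rightarrow> 'v set \<Rightarrow> 'v set \<Rightarrow> bool" for Q where
  empty: "branch Q {} {}"
| node: "branch Q Y A \<Longrightarrow> branch Q Z B \<Longrightarrow> joined Q x Y A Z B \<Longrightarrow>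
    branch Q {x} (insert x (A \<union> B))"

lemma branch_root: "branch Q Y W \<Longrightarrow> Y = {} \<and> W = {} \<or> (\<exists>x. Y = {x} \<and> x \<in> W)"
  by (induction rule: branch.induct) auto

lemma branch_finite: "branch Q Y W \<Longrightarrow> finite W"
  by (induction rule: branch.induct) auto

lemma branch_antisym:
  "branch Q Y W \<Longrightarrow> u \<in> W \<Longrightarrow> w \<in> W \<Longrightarrow> arr Q u w = 0 \<or> arr Q w u = 0"
proof (induction rule: branch.induct)
  case (node Y A Z B x)
  then show ?case unfolding joined_def by (elim insertE UnE) simp_all
qed simp

text \<open>Only arrows inside \<open>W\<close> matter. This carries branches over to a mutated
  quiver and to a full subquiver.\<close>

lemma branch_cong:
  "branch Q Y W \<Longrightarrow> (\<And>u w. u \<in> W \<Longrightarrow> w \<in> W \<Longrightarrow> arr Q' u w = arr Q u w) \<Longrightarrow> branch Q' Y W"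
proof (induction rule: branch.induct)
  case (node Y A Z B x)
  have "joined Q' x Y A Z B"
    using node.hyps(3) node.prems unfolding joined_def by simp
  then show ?case using node by (intro branch.node) auto
qed (rule branch.empty)

lemma branch_singleton: "arr Q x x = 0 \<Longrightarrow> branch Q {x} {x}"
  using branch.node[OF branch.empty branch.empty, of Q x] by (simp add: joined_def)

text \<open>Forgetting directions makes the roles of \<open>A\<close> and \<open>B\<close>
  symmetric: later arguments treat one side and get the other from
  \<open>edge_joined_commute\<close>. The 3-cycles are kept because strings and labels depend on
  them.\<close>

definition edge_joined :: "'v quiver \<Rightarrow> 'v \<Rightarrow> 'v set \<Rightarrow> 'v set \<Rightarrow> 'v set \<Rightarrow> 'v set \<Rightarrow> bool" where
  "edge_joined Q x Y A Z B \<longleftrightarrow>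
     x \<notin> A \<and> x \<notin> B \<and> A \<inter> B = {} \<and> edges Q x x = 0 \<and>
     (\<forall>w\<in>A. edges Q x w = of_bool (w \<in> Y)) \<and>
     (\<forall>w\<in>B. edges Q x w = of_bool (w \<in> Z)) \<and>
     (\<forall>u\<in>A. \<forall>w\<in>B. edges Q u w = of_bool (u \<in> Y \<and> w \<in> Z)) \<and>
     (\<forall>y\<in>Y. \<forall>z\<in>Z. {x, y, z} \<in> three_cycles Q)"

lemma joined_edge_joined:
  assumes "joined Q x Y A Z B" "Y \<subseteq> A" "Z \<subseteq> B"
  shows "edge_joined Q x Y A Z B"
proof -
  have "{x, y, z} \<in> three_cycles Q" if "y \<in> Y" "z \<in> Z" for y z
  proof -
    have "arr Q x y > 0" "arr Q y z > 0" "arr Q z x > 0"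
      using assms that unfolding joined_def by (auto simp: subset_iff)
    then show ?thesis unfolding three_cycles_def by blast
  qed
  then show ?thesis
    using assms unfolding joined_def edge_joined_def edges_def by auto
qed

lemma edge_joined_commute: "edge_joined Q x Y A Z B \<Longrightarrow> edge_joined Q x Z B Y A"
proof -
  assume j: "edge_joined Q x Y A Z B"
  have "edges Q w u = of_bool (w \<in> Z \<and> u \<in> Y)" if "u \<in> A" "w \<in> B" for u w
    using j that unfolding edge_joined_def edges_sym[of Q w u] by (simp add: conj_commute)
  moreover have "{x, z, y} \<in> three_cycles Q" if "y \<in> Y" "z \<in> Z" for y z
    using j that insert_commute[of z y "{}"] unfolding edge_joined_def by simp
  ultimately show ?thesis
    using j unfolding edge_joined_def by (simp add: Int_commute)
qed

lemma branch_edge_induct [consumes 1, case_names empty node]: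
  assumes "branch Q Y W" "P {} {}"
    and "\<And>Y A Z B x. branch Q Y A \<Longrightarrow> P Y A \<Longrightarrow> branch Q Z B \<Longrightarrow> P Z B \<Longrightarrow>
      edge_joined Q x Y A Z B \<Longrightarrow> P {x} (insert x (A \<union> B))"
  shows "P Y W"
  using assms(1)
proof (induction rule: branch.induct)
  case (node Y A Z B x)
  then have "edge_joined Q x Y A Z B"
    by (intro joined_edge_joined) (auto dest: branch_root)
  from assms(3)[OF node.hyps(1) node.IH(1) node.hyps(2) node.IH(2) this] show ?case .
qed (rule assms(2))

lemma branch_has_neighbour:
  assumes "branch Q {x} W" "W \<noteq> {x}"
  shows "\<exists>w\<in>W - {x}. edges Q x w > 0"
proof -
  from assms(1) obtain Y A Z B where node: "W = insert x (A \<union> B)" "branch Q Y A" "branch Q Z B"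
    "joined Q x Y A Z B" by cases auto
  then have ej: "edge_joined Q x Y A Z B"
    by (intro joined_edge_joined) (auto dest: branch_root)
  from node assms(2) have "A \<noteq> {} \<or> B \<noteq> {}" by auto
  then obtain w where "w \<in> Y \<and> w \<in> A \<or> w \<in> Z \<and> w \<in> B"
    using branch_root[OF node(2)] branch_root[OF node(3)] by blast
  with ej node(1) show ?thesis
    by (intro bexI[of _ w]) (auto simp: edge_joined_def)
qed

section \<open>Cutting at an arbitrary vertex\<close>

text \<open>Either half may be just \<open>{x}\<close>, which is how end vertices fit in, among them
  the first vertex of the initial chain.\<close>

definition splits :: "'v quiver \<Rightarrow> 'v set \<Rightarrow> 'v \<Rightarrow> bool" where
  "splits Q V x \<longleftrightarrow> (\<exists>W1 W2. branch Q {x} W1 \<and> branch Q {x} W2 \<and> W1 \<inter> W2 = {x} \<and>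
     V = W1 \<union> W2 \<and> (\<forall>u\<in>W1 - {x}. \<forall>w\<in>W2 - {x}. edges Q u w = 0))"

text \<open>The split is moved from \<open>x\<close> to the neighbouring root of a branch \<open>A\<close> or \<open>B\<close> at \<open>x\<close>: seen from
  there, everything outside that branch forms the second branch.\<close>

lemma splits_reroot:
  assumes "branch Q Y W1"
  shows "Y = {x} \<Longrightarrow> branch Q {x} W2 \<Longrightarrow> W1 \<inter> W2 = {x} \<Longrightarrow>
    \<forall>u\<in>W1 - {x}. \<forall>w\<in>W2 - {x}. edges Q u w = 0 \<Longrightarrow> y \<in> W1 \<Longrightarrow> splits Q (W1 \<union> W2) y"
  using assms
proof (induction arbitrary: x W2 rule: branch.induct)
  case (node Y A Z B x')
  then have [simp]: "x' = x" by simp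
  have j: "joined Q x Y A Z B" using node.hyps(3) by simp
  have sub: "Y \<subseteq> A" "Z \<subseteq> B"
    using branch_root[OF node.hyps(1)] branch_root[OF node.hyps(2)] by auto
  have disj: "A \<inter> W2 = {}" "B \<inter> W2 = {}" "x \<in> W2"
    using node.prems(3) j unfolding joined_def by auto
  have cr: "arr Q u w = 0" "arr Q w u = 0" if "u \<in> A \<union> B" "w \<in> W2" "w \<noteq> x" for u w
  proof -
    have "u \<noteq> x" using that j unfolding joined_def by auto
    then have "edges Q u w = 0" using node.prems(4) that by auto
    then show "arr Q u w = 0" "arr Q w u = 0" by (auto simp: edges_def)
  qed
  have noloop: "arr Q u u = 0" if "u \<in> A \<union> B" for u
    using that branch_antisym[OF node.hyps(1)] branch_antisym[OF node.hyps(2)] by blast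
  consider "y = x" | "y \<in> A" | "y \<in> B" using node.prems(5) by auto
  then show ?case
  proof cases
    case 1
    have "branch Q {x} (insert x (A \<union> B))"
      using branch.node[OF node.hyps] by simp
    then show ?thesis
      unfolding splits_def 1 using node.prems by (intro exI[of _ "insert x' (A \<union> B)"] exI[of _ W2]) simp
  next
    case 2
    then obtain y0 where y0: "Y = {y0}" "y0 \<in> A" using branch_root[OF node.hyps(1)] by auto
    \<comment> \<open>The triangle x -> y0 -> z -> x is read from \<open>y0\<close>: the root of
      \<open>B\<close> is now the target, and \<open>x\<close>, carrying the old second half, is the
      source.\<close>
    have "joined Q y0 Z B {x} W2"
      unfolding joined_def
    proof (intro conjI ballI)
      show "y0 \<notin> B" "y0 \<notin> W2" "B \<inter> W2 = {}" using j disj y0 unfolding joined_def by auto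
      show "arr Q y0 y0 = 0" using noloop y0 by auto
    next
      fix w assume "w \<in> B"
      then show "arr Q y0 w = of_bool (w \<in> Z)" "arr Q w y0 = 0" 
        using j y0 unfolding joined_def by auto
    next
      fix w assume "w \<in> W2"
      then show "arr Q w y0 = of_bool (w \<in> {x})" "arr Q y0 w = 0"
        using j y0 cr[of y0 w] unfolding joined_def by (cases "w = x"; auto)+
    next
      fix u w assume "u \<in> B" "w \<in> W2"
      then show "arr Q u w = of_bool (u \<in> Z \<and> w \<in> {x})" "arr Q w u = 0"
        using j y0 cr[of u w] unfolding joined_def by (cases "w = x"; auto)+
    qed
    with node.hyps(2) node.prems(2) have b: "branch Q {y0} (insert y0 (B \<union> W2))"
      by (rule branch.node)
    have "splits Q (A \<union> insert y0 (B \<union> W2)) y"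
    proof (rule node.IH(1)[OF y0(1) b _ _ 2])
      show "A \<inter> insert y0 (B \<union> W2) = {y0}" using y0 disj j unfolding joined_def by auto
      show "\<forall>u\<in>A - {y0}. \<forall>w\<in>insert y0 (B \<union> W2) - {y0}. edges Q u w = 0"
      proof (intro ballI)
        fix u w assume "u \<in> A - {y0}" "w \<in> insert y0 (B \<union> W2) - {y0}"
        then show "edges Q u w = 0"
          using j y0 cr[of u w] unfolding joined_def edges_def by (cases "w = x") auto
      qed
    qed
    moreover have "A \<union> insert y0 (B \<union> W2) = insert x' (A \<union> B) \<union> W2"
      using y0 disj by auto
    ultimately show ?thesis by simp
  next
    case 3
    then obtain y0 where y0: "Z = {y0}" "y0 \<in> B" using branch_root[OF node.hyps(2)] by auto
    \<comment> \<open>Read from the root of \<open>B\<close>, the triangle has \<open>x\<close> as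
      target and the root of \<open>A\<close> as source.\<close>
    have "joined Q y0 {x} W2 Y A"
      unfolding joined_def
    proof (intro conjI ballI)
      show "y0 \<notin> A" "y0 \<notin> W2" "W2 \<inter> A = {}" using j disj y0 unfolding joined_def by auto
      show "arr Q y0 y0 = 0" using noloop y0 by auto
    next
      fix w assume "w \<in> A"
      then show "arr Q w y0 = of_bool (w \<in> Y)" "arr Q y0 w = 0" 
        using j y0 unfolding joined_def by auto
    next
      fix w assume "w \<in> W2"
      then show "arr Q y0 w = of_bool (w \<in> {x})" "arr Q w y0 = 0"
        using j y0 cr[of y0 w] unfolding joined_def by (cases "w = x"; auto)+
    next
      fix w u assume "u \<in> A" "w \<in> W2"
      then show "arr Q w u = of_bool (w \<in> {x} \<and> u \<in> Y)" "arr Q u w = 0"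
        using j y0 cr[of u w] unfolding joined_def by (cases "w = x"; auto)+
    qed
    with node.prems(2) node.hyps(1) have b: "branch Q {y0} (insert y0 (W2 \<union> A))"
      by (rule branch.node)
    have "splits Q (B \<union> insert y0 (W2 \<union> A)) y"
    proof (rule node.IH(2)[OF y0(1) b _ _ 3])
      show "B \<inter> insert y0 (W2 \<union> A) = {y0}" using y0 disj j unfolding joined_def by auto
      show "\<forall>u\<in>B - {y0}. \<forall>w\<in>insert y0 (W2 \<union> A) - {y0}. edges Q u w = 0"
      proof (intro ballI)
        fix u w assume "u \<in> B - {y0}" "w \<in> insert y0 (W2 \<union> A) - {y0}"
        then show "edges Q u w = 0"
          using j y0 cr[of u w] unfolding joined_def edges_def by (cases "w = x") auto
      qed
    qed
    moreover have "B \<union> insert y0 (W2 \<union> A) = insert x' (A \<union> B) \<union> W2"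
      using y0 disj by auto
    ultimately show ?thesis by simp
  qed
qed simp

lemma splits_everywhere:
  assumes "splits Q V x" "y \<in> V"
  shows "splits Q V y"
proof -
  obtain W1 W2 where W: "branch Q {x} W1" "branch Q {x} W2" "W1 \<inter> W2 = {x}" "V = W1 \<union> W2"
    "\<forall>u\<in>W1 - {x}. \<forall>w\<in>W2 - {x}. edges Q u w = 0"
    using assms(1) unfolding splits_def by blast
  show ?thesis
  proof (cases "y \<in> W1")
    case True
    then show ?thesis using splits_reroot[OF W(1) refl W(2,3,5)] W(4) by simp
  next
    case False
    then have "y \<in> W2" using W assms(2) by simp
    then show ?thesis
      using splits_reroot[OF W(2) refl W(1), of y] W edges_sym[of Q]
      by (metis Int_commute Un_commute)
  qed
qed

section \<open>Invariance under mutation, starting from the linear quiver\<close>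

definition type_A_shape :: "'v quiver \<Rightarrow> bool" where
  "type_A_shape Q \<longleftrightarrow> (\<forall>x y. arr Q x y > 0 \<longrightarrow> x \<in> verts Q \<and> y \<in> verts Q) \<and>
     (\<forall>x\<in>verts Q. splits Q (verts Q) x)"

text \<open>Reversal at \<open>k\<close> turns the targets (roots of \<open>A1\<close>,
  \<open>A2\<close>) into sources and the sources (roots of \<open>B1\<close>, \<open>B2\<close>)
  into targets. The paths through \<open>k\<close> cancel the old arrows from \<open>A1\<close> to
  \<open>B1\<close> and from \<open>A2\<close> to \<open>B2\<close>, and create arrows from
  \<open>B1\<close> to \<open>A2\<close> and from \<open>B2\<close> to \<open>A1\<close>. Hence the
  new halves pair \<open>B1\<close> with \<open>A2\<close> and \<open>B2\<close> with
  \<open>A1\<close>.\<close>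

lemma splits_mutate:
  assumes "splits Q V k"
  shows "splits (mutate k Q) V k"
proof -
  let ?M = "mutate k Q"
  obtain W1 W2 where W: "branch Q {k} W1" "branch Q {k} W2" "W1 \<inter> W2 = {k}" "V = W1 \<union> W2"
    "\<forall>u\<in>W1 - {k}. \<forall>w\<in>W2 - {k}. edges Q u w = 0"
    using assms(1) unfolding splits_def by blast
  from W(1) obtain Y1 A1 Z1 B1 where 1: "W1 = insert k (A1 \<union> B1)" "branch Q Y1 A1"
    "branch Q Z1 B1" "joined Q k Y1 A1 Z1 B1" by cases auto
  from W(2) obtain Y2 A2 Z2 B2 where 2: "W2 = insert k (A2 \<union> B2)" "branch Q Y2 A2"
    "branch Q Z2 B2" "joined Q k Y2 A2 Z2 B2" by cases auto
  have disj: "(A1 \<union> B1) \<inter> (A2 \<union> B2) = {}"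
    using W(3) 1 2 unfolding joined_def by auto
  have cr: "arr Q u w = 0" "arr Q w u = 0" if "u \<in> A1 \<union> B1" "w \<in> A2 \<union> B2" for u w
  proof -
    have "u \<in> W1 - {k}" "w \<in> W2 - {k}" using that 1 2 unfolding joined_def by auto
    then have "edges Q u w = 0" using W(5) by auto
    then show "arr Q u w = 0" "arr Q w u = 0" by (auto simp: edges_def)
  qed
  \<comment> \<open>The vertices of a sub-branch lie all on the same side of \<open>k\<close>, so no
    path through \<open>k\<close> joins two of them; antisymmetry then makes the truncated
    subtraction return the old number of arrows.\<close>
  have out: "arr ?M u w = arr Q u w"
    if "branch Q Y A" "\<forall>w\<in>A. arr Q w k = 0" "k \<notin> A" "u \<in> A" "w \<in> A" for Y A u w
    using that branch_antisym[OF that(1,4,5)] by (auto simp: mutate_def)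
  have in': "arr ?M u w = arr Q u w"
    if "branch Q Y A" "\<forall>w\<in>A. arr Q k w = 0" "k \<notin> A" "u \<in> A" "w \<in> A" for Y A u w
    using that branch_antisym[OF that(1,4,5)] by (auto simp: mutate_def)
  have b: "branch ?M Y1 A1" "branch ?M Z1 B1" "branch ?M Y2 A2" "branch ?M Z2 B2"
    using branch_cong[of Q Y1 A1 ?M, OF 1(2) out[OF 1(2)]] branch_cong[of Q Z1 B1 ?M, OF 1(3) in'[OF 1(3)]]
      branch_cong[of Q Y2 A2 ?M, OF 2(2) out[OF 2(2)]] branch_cong[of Q Z2 B2 ?M, OF 2(3) in'[OF 2(3)]]
      1(4) 2(4) by (simp_all add: joined_def)
  have "joined ?M k Z1 B1 Y2 A2"
    using 1(4) 2(4) disj cr unfolding joined_def mutate_def by auto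
  then have n1: "branch ?M {k} (insert k (B1 \<union> A2))" using b by (intro branch.node)
  have "joined ?M k Z2 B2 Y1 A1"
    using 1(4) 2(4) disj cr unfolding joined_def mutate_def by auto
  then have n2: "branch ?M {k} (insert k (B2 \<union> A1))" using b by (intro branch.node)
  have cross: "edges ?M u w = 0" if "u \<in> insert k (B1 \<union> A2) - {k}" "w \<in> insert k (B2 \<union> A1) - {k}" for u w
    using that 1(4) 2(4) disj cr[of u w] cr[of w u]
    unfolding joined_def mutate_def edges_def by auto
  have "insert k (B1 \<union> A2) \<inter> insert k (B2 \<union> A1) = {k}"
    using 1(4) 2(4) disj unfolding joined_def by blast
  moreover have "V = insert k (B1 \<union> A2) \<union> insert k (B2 \<union> A1)"
    unfolding W(4) 1(1) 2(1) by blast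
  ultimately show ?thesis
    unfolding splits_def using n1 n2 cross by blast
qed

lemma type_A_shape_mutate:
  assumes "type_A_shape Q" "k \<in> verts Q"
  shows "type_A_shape (mutate k Q)"
proof -
  have v: "verts (mutate k Q) = verts Q" by (simp add: mutate_def)
  have "splits (mutate k Q) (verts Q) k"
    using assms by (intro splits_mutate) (simp add: type_A_shape_def)
  then have "\<forall>x\<in>verts Q. splits (mutate k Q) (verts Q) x"
    by (simp add: splits_everywhere)
  moreover have "x \<in> verts Q \<and> y \<in> verts Q" if "arr (mutate k Q) x y > 0" for x y
  proof -
    have "arr Q x y > 0 \<or> arr Q y x > 0 \<or> (arr Q x k > 0 \<and> arr Q k y > 0)"
    proof (rule ccontr)
      assume "\<not> ?thesis"
      then have "arr Q x y = 0" "arr Q y x = 0" "arr Q x k * arr Q k y = 0" by auto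
      then show False using that by (auto simp: mutate_def split: if_splits)
    qed
    then show ?thesis using assms(1) unfolding type_A_shape_def by blast
  qed
  ultimately show ?thesis unfolding type_A_shape_def v by blast
qed

text \<open>The chain is built from its far end \<open>f N\<close>. The direction of the arrow
  between \<open>f i\<close> and \<open>f (Suc i)\<close> decides which side of the new node carries
  the tail; the other side is empty.\<close>

lemma chain_branch:
  assumes "inj_on f {1..N}" "\<And>i. i \<in> {1..N} \<Longrightarrow> arr Q (f i) (f i) = 0"
    and dir: "\<And>i j. arr Q i j = 0 \<or> arr Q j i = 0"
    and e: "\<And>i j. i \<in> {1..N} \<Longrightarrow> j \<in> {1..N} \<Longrightarrow>
      edges Q (f i) (f j) = (if {i, j} \<in> dynkin_A N then 1 else 0)"
    and "1 \<le> i" "i \<le> N"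
  shows "branch Q {f i} (f ` {i..N})"
  using \<open>i \<le> N\<close> \<open>1 \<le> i\<close>
proof (induction rule: inc_induct)
  case base
  then show ?case using branch_singleton[OF assms(2)[of N]] by simp
next
  case (step i)
  define A where A_def: "A = f ` {Suc i..N}"
  have IH: "branch Q {f (Suc i)} A" using step by (simp add: A_def)
  have split: "f ` {i..N} = insert (f i) A"
    using step by (simp add: A_def atLeastAtMost_insertL[symmetric])
  have notin: "f i \<notin> A"
  proof
    assume "f i \<in> A"
    then obtain j where "j \<in> {Suc i..N}" "f i = f j" by (auto simp: A_def)
    then show False using inj_onD[OF assms(1), of i j] step by auto
  qed
  have ed: "edges Q (f i) w = of_bool (w \<in> {f (Suc i)})" if "w \<in> A" for w
  proof -
    from that obtain j where j: "j \<in> {Suc i..N}" "w = f j" by (auto simp: A_def)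
    have "{i, j} \<in> dynkin_A N \<longleftrightarrow> j = Suc i"
      using j step unfolding dynkin_A_def by (auto simp: doubleton_eq_iff)
    moreover have "f j = f (Suc i) \<longleftrightarrow> j = Suc i"
      using inj_onD[OF assms(1), of j "Suc i"] j step by auto
    ultimately show ?thesis using e[of i j] j step by auto
  qed
  have 1: "edges Q (f i) (f (Suc i)) = 1" using ed[of "f (Suc i)"] step by (auto simp: A_def)
  have l: "arr Q (f i) (f i) = 0" using assms(2)[of i] step by auto
  have ed0: "arr Q (f i) w = 0 \<and> arr Q w (f i) = 0" if "w \<in> A" "w \<noteq> f (Suc i)" for w
    using ed[OF that(1)] that(2) by (simp add: edges_def)
  show ?case
  proof (cases "arr Q (f i) (f (Suc i)) = 0")
    case True
    have "joined Q (f i) {} {} {f (Suc i)} A"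
      using notin l ed0 1 True unfolding joined_def edges_def by auto
    from branch.node[OF branch.empty IH this] show ?thesis unfolding split by simp
  next
    case False
    then have "arr Q (f (Suc i)) (f i) = 0" using dir[of "f i" "f (Suc i)"] by simp
    then have "joined Q (f i) {f (Suc i)} A {} {}"
      using notin l ed0 1 unfolding joined_def edges_def by auto
    from branch.node[OF IH branch.empty this] show ?thesis unfolding split by simp
  qed
qed

lemma mutation_type_A_shape:
  assumes "mutation_type N (dynkin_A N) Q" "N \<ge> 1"
  shows "type_A_shape Q" and "card (verts Q) = N"
proof -
  obtain Q0 f where Q0: "is_quiver Q0" "mutation_step\<^sup>*\<^sup>* Q0 Q" and f: "bij_betw f {1..N} (verts Q0)"
    and e: "\<And>i j. i \<in> {1..N} \<Longrightarrow> j \<in> {1..N} \<Longrightarrow>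
      edges Q0 (f i) (f j) = (if {i, j} \<in> dynkin_A N then 1 else 0)"
    using assms(1) unfolding mutation_type_def underlying_graph_is_def by blast
  have V: "verts Q0 = f ` {1..N}" using f by (simp add: bij_betw_def)
  have l: "arr Q0 (f 1) (f 1) = 0" using Q0 by (simp add: is_quiver_def)
  have "branch Q0 {f 1} (f ` {1..N})"
    using f e Q0(1) assms(2)
    by (intro chain_branch[of f N]) (auto simp: bij_betw_def is_quiver_def)
  then have "splits Q0 (verts Q0) (f 1)"
    unfolding splits_def V using branch_singleton[of Q0 "f 1", OF l] assms(2)
    by (intro exI[of _ "f ` {1..N}"] exI[of _ "{f 1}"]) auto
  then have "type_A_shape Q0"
    using Q0(1) by (simp add: type_A_shape_def is_quiver_def splits_everywhere)
  moreover have "card (verts Q0) = N" using f by (auto dest: bij_betw_same_card)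
  ultimately have "type_A_shape Q0 \<and> card (verts Q0) = N" by simp
  with Q0(2) have "type_A_shape Q \<and> card (verts Q) = N"
  proof (induction rule: converse_rtranclp_induct)
    case (step Q1 Q2)
    from step.hyps(1) obtain k where "k \<in> verts Q1" "Q2 = mutate k Q1"
      unfolding mutation_step_def by blast
    then have "type_A_shape Q2 \<and> card (verts Q2) = N"
      using type_A_shape_mutate[of Q1 k] step.prems by (simp add: mutate_def)
    then show ?case by (rule step.IH)
  qed simp
  then show "type_A_shape Q" "card (verts Q) = N" by auto
qed

section \<open>End vertices as roots of branches\<close>

text \<open>In a tree of edges and triangles this says, without valencies, that all neighbours lie
  in one edge or triangle.\<close>

definition simplicial :: "'v quiver \<Rightarrow> 'v \<Rightarrow> bool" where
  "simplicial Q e \<longleftrightarrow>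
     (\<forall>u v. edges Q e u > 0 \<longrightarrow> edges Q e v > 0 \<longrightarrow> u \<noteq> v \<longrightarrow> edges Q u v > 0)"

text \<open>Two distinct neighbours rule out valency at most one, so \<open>e\<close> lies on a
  3-cycle. The other two vertices of that cycle exhaust the valency 2, hence they are the only
  neighbours, and they are adjacent.\<close>

lemma end_vertex_simplicial:
  assumes fin: "finite (verts Q)" and supp: "\<And>x y. arr Q x y > 0 \<Longrightarrow> x \<in> verts Q \<and> y \<in> verts Q"
    and loop: "\<And>x. x \<in> verts Q \<Longrightarrow> arr Q x x = 0" and e: "end_vertex Q e"
  shows "simplicial Q e"
  unfolding simplicial_def
proof (intro allI impI)
  fix u v assume uv: "edges Q e u > 0" "edges Q e v > 0" "u \<noteq> v"
  have inV: "w \<in> verts Q" if "edges Q e w > 0" for w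
    using that supp by (auto simp: edges_def)
  have le: "sum (edges Q e) X \<le> valency Q e" if "X \<subseteq> verts Q" for X
    unfolding valency_def using fin that by (intro sum_mono2) auto
  have "edges Q e u + edges Q e v \<le> valency Q e"
    using le[of "{u, v}"] uv inV by simp
  then have val: "valency Q e = 2" "\<exists>C\<in>three_cycles Q. e \<in> C"
    using e uv unfolding end_vertex_def by auto
  then obtain C where C: "C \<in> three_cycles Q" "e \<in> C" by blast
  then obtain x y z where xyz: "C = {x, y, z}" "arr Q x y > 0" "arr Q y z > 0" "arr Q z x > 0"
    unfolding three_cycles_def by blast
  then have "distinct [x, y, z]" using loop supp by (metis distinct_length_2_or_more distinct_singleton less_irrefl)
  then obtain p q where pq: "C = {e, p, q}" "distinct [e, p, q]"
    using C(2) xyz(1) by (auto simp: insert_commute)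
  have epq: "edges Q e p > 0" "edges Q e q > 0" "edges Q p q > 0"
    using three_cycles_edges[OF C(1)] pq by auto
  have only: "w = p \<or> w = q" if "edges Q e w > 0" for w
  proof (rule ccontr)
    assume "\<not> (w = p \<or> w = q)"
    then have "sum (edges Q e) {w, p, q} = edges Q e w + edges Q e p + edges Q e q"
      using pq(2) by simp
    then have "edges Q e w + edges Q e p + edges Q e q \<le> 2"
      using le[of "{w, p, q}"] that epq inV val by simp
    moreover have "edges Q e w + edges Q e p + edges Q e q > 2" using that epq by simp
    ultimately show False by simp
  qed
  show "edges Q u v > 0"
    using only[OF uv(1)] only[OF uv(2)] uv(3) epq edges_sym[of Q] by metis
qed

lemma branch_no_loop: "branch Q Y W \<Longrightarrow> x \<in> W \<Longrightarrow> arr Q x x = 0"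
  using branch_antisym[of Q Y W x x] by simp

text \<open>If both halves at \<open>v\<close> were nontrivial, each would contain a neighbour of
  \<open>v\<close>. These neighbours would have to be adjacent, but no edge crosses between the
  halves.\<close>

lemma end_vertex_branch:
  assumes "type_A_shape Q" "end_vertex Q v"
  shows "branch Q {v} (verts Q)"
proof -
  have vV: "v \<in> verts Q" using assms(2) by (simp add: end_vertex_def)
  then have "splits Q (verts Q) v" using assms(1) by (simp add: type_A_shape_def)
  then obtain W1 W2 where W: "branch Q {v} W1" "branch Q {v} W2" "W1 \<inter> W2 = {v}"
    "verts Q = W1 \<union> W2" "\<forall>u\<in>W1 - {v}. \<forall>w\<in>W2 - {v}. edges Q u w = 0"
    unfolding splits_def by blast
  have "simplicial Q v"
  proof (rule end_vertex_simplicial)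
    show "finite (verts Q)" using W branch_finite by auto
    show "arr Q x x = 0" if "x \<in> verts Q" for x
      using that W(4) branch_no_loop[OF W(1)] branch_no_loop[OF W(2)] by blast
  qed (use assms in \<open>auto simp: type_A_shape_def\<close>)
  have "W1 = {v} \<or> W2 = {v}"
  proof (rule ccontr)
    assume "\<not> (W1 = {v} \<or> W2 = {v})"
    then obtain u w where "u \<in> W1 - {v}" "edges Q v u > 0" "w \<in> W2 - {v}" "edges Q v w > 0"
      using branch_has_neighbour[OF W(1)] branch_has_neighbour[OF W(2)] by blast
    moreover from this have "u \<noteq> w" using W(3) by auto
    ultimately have "edges Q u w > 0" using \<open>simplicial Q v\<close> by (simp add: simplicial_def)
    then show False using W(5) \<open>u \<in> W1 - {v}\<close> \<open>w \<in> W2 - {v}\<close> by simp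
  qed
  then show ?thesis
  proof
    assume "W1 = {v}"
    then have "verts Q = W2" using W by auto
    then show ?thesis using W by simp
  next
    assume "W2 = {v}"
    then have "verts Q = W1" using W by auto
    then show ?thesis using W by simp
  qed
qed

section \<open>Strings\<close>

text \<open>The local conditions of a string, detached from endpoints and vertex set so that
  prefixes and reversals can be taken.\<close>

definition walk :: "'v quiver \<Rightarrow> 'v list \<Rightarrow> bool" where
  "walk Q p \<longleftrightarrow>
     (\<forall>m. Suc m < length p \<longrightarrow> edges Q (p ! m) (p ! Suc m) > 0) \<and>
     (\<forall>m. Suc (Suc m) < length p \<longrightarrow>
        p ! m \<noteq> p ! Suc (Suc m) \<and>
        {p ! m, p ! Suc m, p ! Suc (Suc m)} \<notin> three_cycles Q)"

lemma string_from_to_walk: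
  "string_from_to Q i j p \<longleftrightarrow>
     p \<noteq> [] \<and> hd p = i \<and> last p = j \<and> set p \<subseteq> verts Q \<and> walk Q p"
  by (simp add: string_from_to_def walk_def)

lemma walk_singleton: "walk Q [x]"
  by (simp add: walk_def)

lemma walk_Cons_Cons:
  "walk Q (x # y # r) \<longleftrightarrow> edges Q x y > 0 \<and>
     (r \<noteq> [] \<longrightarrow> x \<noteq> hd r \<and> {x, y, hd r} \<notin> three_cycles Q) \<and> walk Q (y # r)"
proof -
  have split: "(\<forall>m. P m) \<longleftrightarrow> P 0 \<and> (\<forall>m. P (Suc m))" for P :: "nat \<Rightarrow> bool"
    by (metis nat.exhaust)
  have hd: "r \<noteq> [] \<Longrightarrow> r ! 0 = hd r" by (simp add: hd_conv_nth)
  show ?thesis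
    unfolding walk_def
    by (subst split, subst (2) split) (auto simp: hd)
qed

lemma walk_append:
  assumes "walk Q (p @ r)"
  shows "walk Q p"
proof -
  have "(p @ r) ! m = p ! m" if "m < length p" for m using that by (simp add: nth_append)
  with assms show ?thesis unfolding walk_def
    by (metis Suc_lessD length_append trans_less_add1)
qed

lemma walk_rev:
  assumes "walk Q p"
  shows "walk Q (rev p)"
  unfolding walk_def
proof (intro conjI allI impI)
  fix m assume m: "Suc m < length (rev p)"
  define j where "j = length p - Suc (Suc m)"
  have "rev p ! m = p ! Suc j" "rev p ! Suc m = p ! j" "Suc j < length p"
    using m by (auto simp: rev_nth j_def Suc_diff_Suc)
  then show "edges Q (rev p ! m) (rev p ! Suc m) > 0"
    using assms by (simp add: walk_def edges_sym)
next
  fix m assume m: "Suc (Suc m) < length (rev p)"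
  define j where "j = length p - Suc (Suc (Suc m))"
  have j: "rev p ! m = p ! Suc (Suc j)" "rev p ! Suc m = p ! Suc j" "rev p ! Suc (Suc m) = p ! j"
    "Suc (Suc j) < length p"
    using m by (auto simp: rev_nth j_def Suc_diff_Suc)
  have "{p ! Suc (Suc j), p ! Suc j, p ! j} = {p ! j, p ! Suc j, p ! Suc (Suc j)}" by auto
  then show "rev p ! m \<noteq> rev p ! Suc (Suc m)"
    "{rev p ! m, rev p ! Suc m, rev p ! Suc (Suc m)} \<notin> three_cycles Q"
    unfolding j using assms j(4) unfolding walk_def by metis+
qed

text \<open>A path without repetitions or chords; adjacency of consecutive entries is left to
  \<open>walk\<close>.\<close>

primrec induced :: "'v quiver \<Rightarrow> 'v list \<Rightarrow> bool" where
  "induced Q [] = True"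
| "induced Q (x # p) \<longleftrightarrow>
     x \<notin> set p \<and> (\<forall>w\<in>set (tl p). edges Q x w = 0) \<and> induced Q p"

lemma induced_nth:
  "induced Q p \<Longrightarrow> i < j \<Longrightarrow> j < length p \<Longrightarrow>
     p ! i \<noteq> p ! j \<and> (edges Q (p ! i) (p ! j) > 0 \<longrightarrow> j = Suc i)"
proof (induction p arbitrary: i j)
  case (Cons x p)
  then obtain j' where j: "j = Suc j'" by (cases j) auto
  show ?case
  proof (cases i)
    case 0
    have "p ! j' \<in> set (tl p)" if "j' \<noteq> 0"
    proof -
      from that obtain k where "j' = Suc k" by (cases j') auto
      then have "p ! j' = tl p ! k" "k < length (tl p)"
        using Cons.prems j by (auto simp: nth_tl)
      then show ?thesis by simp
    qed
    then show ?thesis using 0 j Cons.prems by (cases j') auto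
  next
    case (Suc i')
    then show ?thesis using Cons.IH[of i' j'] Cons.prems j by simp
  qed
qed simp

text \<open>A walk that has entered \<open>A\<close> can leave it only from its root
  \<open>y\<close>. Leaving directly after entry means returning to \<open>x\<close> or completing a
  triangle, both forbidden; leaving later requires a second visit to \<open>y\<close>, which the
  hypothesis on walks from \<open>y\<close> excludes. The same holds for \<open>B\<close>.\<close>

lemma walk_side:
  assumes ej: "edge_joined Q x Y A Z B" and Y: "Y = {} \<or> (\<exists>y. Y = {y})" and Z: "Z = {} \<or> (\<exists>z. Z = {z})"
    and A: "\<And>y p. Y = {y} \<Longrightarrow> walk Q (y # p) \<Longrightarrow> set p \<subseteq> A \<Longrightarrow> y \<notin> set p"
    and B: "\<And>z p. Z = {z} \<Longrightarrow> walk Q (z # p) \<Longrightarrow> set p \<subseteq> B \<Longrightarrow> z \<notin> set p"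
    and p: "walk Q (x # p)" "set p \<subseteq> insert x (A \<union> B)"
  shows "p = [] \<or> (hd p \<in> Y \<and> set p \<subseteq> A) \<or> (hd p \<in> Z \<and> set p \<subseteq> B)"
  using p
proof (induction p rule: rev_induct)
  case (snoc w p)
  have wp: "walk Q (x # p)" using snoc.prems(1) walk_append[of Q "x # p" "[w]"] by simp
  have stay: "hd (p @ [w]) \<in> Y \<and> set (p @ [w]) \<subseteq> A"
    if ej: "edge_joined Q x Y A Z B" and Y: "Y = {} \<or> (\<exists>y. Y = {y})"
      and A: "\<And>y p. Y = {y} \<Longrightarrow> walk Q (y # p) \<Longrightarrow> set p \<subseteq> A \<Longrightarrow> y \<notin> set p"
      and p: "p \<noteq> []" "hd p \<in> Y" "set p \<subseteq> A" and w: "w \<in> insert x (A \<union> B)" for Y A Z B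
  proof (cases "w \<in> A")
    case True
    then show ?thesis using p by simp
  next
    case False
    from p(1,2) Y obtain y p' where y: "p = y # p'" "Y = {y}" by (cases p) auto
    have "edges Q (last p) w > 0"
      using snoc.prems(1) p(1) unfolding walk_def
      by (auto dest!: spec[of _ "length p"] simp: nth_append last_conv_nth nth_Cons')
    moreover have "last p \<in> A" using p by auto
    ultimately have l: "last p = y" "w = x \<or> w \<in> Z"
      using ej w False y(2) edges_sym[of Q "last p" x] unfolding edge_joined_def
      by (auto split: if_splits)
    show ?thesis
    proof (cases "p' = []")
      case True
      then have "x \<noteq> w" "{x, y, w} \<notin> three_cycles Q"
        using snoc.prems(1) y(1) by (auto simp: walk_Cons_Cons)
      then show ?thesis using l(2) ej y(2) unfolding edge_joined_def by auto
    next
      case False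
      then have "y \<in> set p'" using l(1) y(1) by (metis last_ConsR last_in_set)
      moreover have "walk Q (y # p')" using wp y(1) by (simp add: walk_Cons_Cons)
      ultimately show ?thesis using A[OF y(2)] p(3) y(1) by auto
    qed
  qed
  show ?case
  proof (cases "p = []")
    case True
    then have "edges Q x w > 0" "w \<in> insert x (A \<union> B)"
      using snoc.prems by (auto simp: walk_Cons_Cons)
    then show ?thesis using True ej unfolding edge_joined_def by auto
  next
    case False
    have inw: "w \<in> insert x (A \<union> B)" "w \<in> insert x (B \<union> A)" using snoc.prems(2) by auto
    consider "hd p \<in> Y \<and> set p \<subseteq> A" | "hd p \<in> Z \<and> set p \<subseteq> B"
      using snoc.IH[OF wp] snoc.prems(2) False by auto
    then show ?thesis
    proof cases
      case 1
      then have "hd (p @ [w]) \<in> Y \<and> set (p @ [w]) \<subseteq> A"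
        using inw by (intro stay[OF ej Y A False]) auto
      then show ?thesis by simp
    next
      case 2
      then have "hd (p @ [w]) \<in> Z \<and> set (p @ [w]) \<subseteq> B"
        using inw
        by (intro stay[OF edge_joined_commute[OF ej] Z B False]) auto
      then show ?thesis by simp
    qed
  qed
qed simp

text \<open>By \<open>walk_side\<close> the walk stays in one sub-branch, of which \<open>x\<close>
  sees only the root. This excludes chords at \<open>x\<close>, and the induction hypothesis handles
  the rest.\<close>

lemma walk_induced:
  assumes "branch Q Y W"
  shows "Y = {x} \<Longrightarrow> walk Q (x # p) \<Longrightarrow> set p \<subseteq> W \<Longrightarrow> induced Q (x # p)"
  using assms
proof (induction arbitrary: x p rule: branch_edge_induct)
  case (node Y A Z B x')
  then have ej: "edge_joined Q x Y A Z B" by simp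
  have "p = [] \<or> (hd p \<in> Y \<and> set p \<subseteq> A) \<or> (hd p \<in> Z \<and> set p \<subseteq> B)"
  proof (rule walk_side[OF ej])
    show "Y = {} \<or> (\<exists>y. Y = {y})" "Z = {} \<or> (\<exists>z. Z = {z})"
      using branch_root[OF node.hyps(1)] branch_root[OF node.hyps(2)] by auto
    show "y \<notin> set p" if "Y = {y}" "walk Q (y # p)" "set p \<subseteq> A" for y p
      using node.IH(1)[OF that] by simp
    show "z \<notin> set p" if "Z = {z}" "walk Q (z # p)" "set p \<subseteq> B" for z p
      using node.IH(2)[OF that] by simp
  qed (use node.prems in auto)
  moreover have "induced Q (x # p)"
    if ej: "edge_joined Q x Y A Z B" and br: "branch Q Y A"
      and IH: "\<And>y p. Y = {y} \<Longrightarrow> walk Q (y # p) \<Longrightarrow> set p \<subseteq> A \<Longrightarrow> induced Q (y # p)"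
      and p: "p \<noteq> []" "hd p \<in> Y" "set p \<subseteq> A" for Y A Z B
  proof -
    from p(1,2) branch_root[OF br] obtain y p' where y: "p = y # p'" "Y = {y}" by (cases p) auto
    have "walk Q (y # p')" using node.prems(2) y by (simp add: walk_Cons_Cons)
    then have ind: "induced Q (y # p')" using IH[OF y(2)] p(3) y(1) by auto
    moreover have "x \<notin> set p" using ej p(3) unfolding edge_joined_def by auto
    moreover have "edges Q x w = 0" if "w \<in> set p'" for w
      using that ind ej p(3) y unfolding edge_joined_def by auto
    ultimately show ?thesis using y(1) by simp
  qed
  ultimately show ?case
    using node.hyps node.IH ej edge_joined_commute[OF ej]
    by (metis empty_iff induced.simps list.sel(2) list.set(1))
qed simp

lemma walk_exists:
  assumes "branch Q Y W"
  shows "Y = {x} \<Longrightarrow> w \<in> W \<Longrightarrow> \<exists>p. walk Q (x # p) \<and> set p \<subseteq> W \<and> last (x # p) = w"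
  using assms
proof (induction arbitrary: x rule: branch_edge_induct)
  case (node Y A Z B x')
  then have ej: "edge_joined Q x Y A Z B" by simp
  have ext: "\<exists>p. walk Q (x # p) \<and> set p \<subseteq> A \<and> last (x # p) = w"
    if ej: "edge_joined Q x Y A Z B" and br: "branch Q Y A"
      and IH: "\<And>y. Y = {y} \<Longrightarrow> w \<in> A \<Longrightarrow> \<exists>p. walk Q (y # p) \<and> set p \<subseteq> A \<and> last (y # p) = w"
      and w: "w \<in> A" for Y A Z B
  proof -
    obtain y where y: "Y = {y}" "y \<in> A" using w branch_root[OF br] by auto
    obtain p where p: "walk Q (y # p)" "set p \<subseteq> A" "last (y # p) = w" using IH[OF y(1) w] by blast
    have ind: "y \<notin> set p" using walk_induced[OF br y(1) p(1,2)] by simp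
    have "walk Q (x # y # p)"
      unfolding walk_Cons_Cons
    proof (intro conjI impI p(1))
      show "edges Q x y > 0" using ej y unfolding edge_joined_def by auto
      assume "p \<noteq> []"
      then have h: "hd p \<in> A" "hd p \<noteq> y" "hd p \<noteq> x"
        using p(2) ind ej unfolding edge_joined_def by (auto dest: hd_in_set)
      \<comment> \<open>The vertex after \<open>y\<close> lies in \<open>A\<close> and is not its
        root, so it is not adjacent to \<open>x\<close> and cannot complete a 3-cycle with
        \<open>x\<close> and \<open>y\<close>.\<close>
      then have "edges Q x (hd p) = 0" using ej y unfolding edge_joined_def by auto
      with h show "x \<noteq> hd p" "{x, y, hd p} \<notin> three_cycles Q"
        using three_cycles_edges[of "{x, y, hd p}" Q x "hd p"] by auto
    qed
    with p y show ?thesis by (intro exI[of _ "y # p"]) auto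
  qed
  consider "w = x" | "w \<in> A" | "w \<in> B" using node.prems by auto
  then show ?case
  proof cases
    case 1
    then show ?thesis by (intro exI[of _ "[]"]) (simp add: walk_singleton)
  next
    case 2
    then show ?thesis using ext[OF ej node.hyps(1) node.IH(1)] by blast
  next
    case 3
    then show ?thesis using ext[OF edge_joined_commute[OF ej] node.hyps(2) node.IH(2)] by blast
  qed
qed simp

text \<open>All edges out of \<open>B\<close> end at \<open>x\<close> or \<open>y\<close>, so a
  string avoiding these two stays in \<open>B\<close>; conversely \<open>walk_exists\<close> reaches
  every vertex of \<open>B\<close>. This identifies the quiver of a recursive call with a
  complementary sub-branch.\<close>

lemma rooted_subquiver_branch:
  assumes br: "branch Q {z} B" and B: "B \<subseteq> verts Q"
    and closed: "\<And>u w. u \<in> B \<Longrightarrow> w \<notin> B \<Longrightarrow> edges Q u w > 0 \<Longrightarrow> w = x \<or> w = y"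
    and notin: "x \<notin> B" "y \<notin> B"
  shows "rooted_subquiver Q z x y = full_subquiver Q B"
proof -
  have zB: "z \<in> B" using branch_root[OF br] by auto
  have "w \<in> B" if s: "string_from_to Q z w p" and av: "x \<notin> set p" "y \<notin> set p" for w p
  proof -
    have "p ! m \<in> B" if "m < length p" for m
      using that
    proof (induction m)
      case 0
      then show ?case using s zB by (simp add: string_from_to_walk hd_conv_nth)
    next
      case (Suc m)
      then have "edges Q (p ! m) (p ! Suc m) > 0" using s by (simp add: string_from_to_def)
      moreover have "p ! Suc m \<noteq> x" "p ! Suc m \<noteq> y" using av Suc.prems nth_mem by metis+
      ultimately show ?case using closed Suc by (meson Suc_lessD)
    qed
    moreover have "w = p ! (length p - 1)" "length p - 1 < length p"
      using s by (auto simp: string_from_to_def last_conv_nth)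
    ultimately show ?thesis by simp
  qed
  moreover have "\<exists>p. string_from_to Q z w p \<and> x \<notin> set p \<and> y \<notin> set p" if w: "w \<in> B" for w
  proof -
    obtain p where "walk Q (z # p)" "set p \<subseteq> B" "last (z # p) = w"
      using walk_exists[OF br refl w] by blast
    then show ?thesis
      using zB B notin by (intro exI[of _ "z # p"]) (auto simp: string_from_to_walk)
  qed
  ultimately show ?thesis unfolding rooted_subquiver_def by (intro arg_cong[of _ _ "full_subquiver Q"]) blast
qed

section \<open>Labellings\<close>

text \<open>Three cyclic steps within two vertices must contain a loop. In a quiver without loops
  the third vertex of a 3-cycle therefore differs from the other two.\<close>

lemma three_cycles_doubleton:
  assumes "{x, y} \<in> three_cycles Q"
  shows "arr Q x x > 0 \<or> arr Q y y > 0"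
proof -
  obtain a b c where abc: "{x, y} = {a, b, c}" "arr Q a b > 0" "arr Q b c > 0" "arr Q c a > 0"
    using assms unfolding three_cycles_def by blast
  from abc(1) have "a = x \<or> a = y" "b = x \<or> b = y" "c = x \<or> c = y" by blast+
  then show ?thesis using abc(2-) by (elim disjE) simp_all
qed

lemma three_cycles_full_subquiver:
  "C \<subseteq> W \<Longrightarrow> C \<in> three_cycles (full_subquiver Q W) \<longleftrightarrow> C \<in> three_cycles Q"
  unfolding three_cycles_def full_subquiver_def by (auto split: if_splits)

text \<open>Restricting to \<open>W\<close> lets the notion refer to a single block of
  labels.\<close>

definition complementary_in :: "'v quiver \<Rightarrow> 'v set \<Rightarrow> ('v \<Rightarrow> nat) \<Rightarrow> 'v \<Rightarrow> 'v \<Rightarrow> bool" where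
  "complementary_in Q W L x z \<longleftrightarrow> (\<exists>y. x \<in> W \<and> z \<in> W \<and> y \<in> W \<and>
     {x, z, y} \<in> three_cycles Q \<and> L x < L z \<and> L z < L y)"

text \<open>In coordinates \<open>\<alpha> i = \<epsilon> i - \<epsilon> (i + 1)\<close>, the root attached to \<open>x\<close> is \<open>\<epsilon> (L x) - \<epsilon> (c x)\<close>; two
  such roots with distinct initial points are non-orthogonal iff they share an index.\<close>

definition good_labelling ::
    "'v quiver \<Rightarrow> 'v set \<Rightarrow> ('v \<Rightarrow> nat) \<Rightarrow> nat \<Rightarrow> ('v \<Rightarrow> nat) \<Rightarrow> bool" where
  "good_labelling Q W L l c \<longleftrightarrow>
     bij_betw L W {l<..l + card W} \<and>
     (\<forall>x\<in>W. L x < c x) \<and>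
     (\<forall>x z. complementary_in Q W L x z \<longrightarrow> c x = Suc (L z)) \<and>
     (\<forall>x\<in>W. (\<nexists>z. complementary_in Q W L x z) \<longrightarrow> c x = Suc (L x)) \<and>
     (\<forall>x\<in>W. \<forall>y\<in>W. x \<noteq> y \<longrightarrow>
        edges Q x y = of_bool (c x = L y \<or> c y = L x \<or> c x = c y))"

lemma good_labellingD:
  assumes "good_labelling Q W L l c"
  shows "bij_betw L W {l<..l + card W}"
    and "x \<in> W \<Longrightarrow> L x < c x"
    and "complementary_in Q W L x z \<Longrightarrow> c x = Suc (L z)"
    and "x \<in> W \<Longrightarrow> \<nexists>z. complementary_in Q W L x z \<Longrightarrow> c x = Suc (L x)"
    and "x \<in> W \<Longrightarrow> y \<in> W \<Longrightarrow> x \<noteq> y \<Longrightarrow>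
      edges Q x y = of_bool (c x = L y \<or> c y = L x \<or> c x = c y)"
proof -
  note a = assms[unfolded good_labelling_def]
  show "bij_betw L W {l<..l + card W}" using a by (elim conjE)
  show "x \<in> W \<Longrightarrow> L x < c x" using a by (elim conjE) (erule (1) bspec)
  show "complementary_in Q W L x z \<Longrightarrow> c x = Suc (L z)" using a by (elim conjE) iprover
  show "x \<in> W \<Longrightarrow> \<nexists>z. complementary_in Q W L x z \<Longrightarrow> c x = Suc (L x)"
    using a by (elim conjE) (drule (1) bspec, erule (1) mp)
  have "\<forall>x\<in>W. \<forall>y\<in>W. x \<noteq> y \<longrightarrow> edges Q x y = of_bool (c x = L y \<or> c y = L x \<or> c x = c y)"
    using a by (elim conjE)
  then show "x \<in> W \<Longrightarrow> y \<in> W \<Longrightarrow> x \<noteq> y \<Longrightarrow>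
      edges Q x y = of_bool (c x = L y \<or> c y = L x \<or> c x = c y)" by simp
qed

lemma good_labelling_range:
  assumes "good_labelling Q W L l c" "x \<in> W"
  shows "l < L x" "L x \<le> l + card W"
proof -
  have "L x \<in> {l<..l + card W}"
    using bij_betwE[OF good_labellingD(1)[OF assms(1)]] assms(2) by blast
  then show "l < L x" "L x \<le> l + card W" by auto
qed

text \<open>A primary vertex needs two larger labels in \<open>W\<close>, so the vertex with the
  largest label is not primary.\<close>

lemma good_labelling_last:
  assumes "good_labelling Q W L l c" "x \<in> W" "L x = l + card W"
  shows "c x = Suc (l + card W)" "\<not> complementary_in Q W L x z"
proof -
  show n: "\<not> complementary_in Q W L x z" for z
    using good_labelling_range(2)[OF assms(1)] assms(3) unfolding complementary_in_def
    by (metis le_less_trans not_less_iff_gr_or_eq)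
  then show "c x = Suc (l + card W)" using good_labellingD(4)[OF assms(1,2)] assms(3) by simp
qed

text \<open>If \<open>x\<close> is primary, the secondary vertex has a label above that of the
  complementary one, hence at least \<open>c x\<close>. With \<open>good_labelling_last\<close> this
  says that only the last vertex of a block reaches beyond the labels of the block.\<close>

lemma good_labelling_upper:
  assumes "good_labelling Q W L l c" "x \<in> W" "L x \<noteq> l + card W"
  shows "c x \<le> l + card W"
proof (cases "\<exists>z. complementary_in Q W L x z")
  case True
  then obtain z y where z: "complementary_in Q W L x z" "y \<in> W" "L z < L y"
    unfolding complementary_in_def by blast
  then have "c x = Suc (L z)" using good_labellingD(3)[OF assms(1)] by simp
  then show ?thesis using z good_labelling_range(2)[OF assms(1) z(2)] by simp
next
  case False
  then have "c x = Suc (L x)" using good_labellingD(4)[OF assms(1,2)] by simp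
  then show ?thesis using assms(3) good_labelling_range(2)[OF assms(1,2)] by simp
qed

lemma good_labelling_empty: "good_labelling Q {} L l c"
  by (simp add: good_labelling_def complementary_in_def bij_betw_def)

lemma good_labelling_singleton:
  "L f = Suc l \<Longrightarrow> good_labelling Q {f} L l (\<lambda>_. Suc (Suc l))"
  by (auto simp: good_labelling_def complementary_in_def bij_betw_def)

lemma good_labelling_full_subquiver:
  assumes g: "good_labelling (full_subquiver Q B) B L' 0 c" and L: "\<And>w. w \<in> B \<Longrightarrow> L w = s + L' w"
  shows "good_labelling Q B L s (\<lambda>x. s + c x)"
proof -
  have comp: "complementary_in Q B L x z \<longleftrightarrow> complementary_in (full_subquiver Q B) B L' x z" for x z
    unfolding complementary_in_def using L by (auto simp: three_cycles_full_subquiver)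
  have "bij_betw L' B {0<..card B}" using g by (simp add: good_labelling_def)
  moreover have "bij_betw ((+) s) {0<..card B} {s<..s + card B}"
    by (intro bij_betwI[where g = "\<lambda>x. x - s"]) auto
  ultimately have "bij_betw ((+) s \<circ> L') B {s<..s + card B}" by (rule bij_betw_trans)
  then have bij: "bij_betw L B {s<..s + card B}"
    by (rule bij_betw_cong[THEN iffD1, rotated]) (simp add: L)
  have ed: "edges (full_subquiver Q B) x y = edges Q x y" if "x \<in> B" "y \<in> B" for x y
    using that by (simp add: edges_def full_subquiver_def)
  have "L z = s + L' z" if "complementary_in (full_subquiver Q B) B L' x z" for x z
    using that L unfolding complementary_in_def by blast
  then show ?thesis
    using g bij ed L unfolding good_labelling_def comp by simp
qed

text \<open>This is one move along the string: \<open>A\<close> is the part labelled so far, ending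
  at \<open>y\<close>; \<open>B\<close> is the complementary block, possibly empty; \<open>f\<close>
  is the next vertex.\<close>

lemma good_labelling_join:
  assumes ej: "edge_joined Q f {y} A Z B" and fin: "finite A" "finite B" and y: "y \<in> A"
    and Z: "Z = {} \<and> B = {} \<or> (\<exists>z. Z = {z} \<and> z \<in> B)"
    and gA: "good_labelling Q A L l cA" and Ly: "L y = l + card A"
    and gB: "good_labelling Q B L (l + card A) cB"
    and Lz: "\<And>z. z \<in> Z \<Longrightarrow> L z = l + card A + card B"
    and Lf: "L f = Suc (l + card A + card B)"
  shows "\<exists>c. good_labelling Q (insert f (A \<union> B)) L l c"
proof -
  let ?W = "insert f (A \<union> B)"
  \<comment> \<open>The endpoint of \<open>y\<close> becomes \<open>L f\<close>. If \<open>B\<close>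
    is nonempty with root \<open>z\<close>, then \<open>y\<close> turns primary and
    \<open>Suc (L z) = L f\<close>; the old endpoint would collide with the first label of
    \<open>B\<close>. If \<open>B\<close> is empty, \<open>L f = Suc (L y)\<close> and the value is
    the old one.\<close>
  define c where "c x = (if x = f then Suc (L f) else if x = y then L f
    else if x \<in> A then cA x else cB x)" for x
  have f: "f \<notin> A" "f \<notin> B" and AB: "A \<inter> B = {}" using ej unfolding edge_joined_def by auto
  have yf: "y \<noteq> f" "y \<notin> B" using y f AB by auto
  have cA: "c x = cA x" if "x \<in> A" "x \<noteq> y" for x using that f by (auto simp: c_def)
  have cB: "c x = cB x" if "x \<in> B" for x using that f AB yf by (auto simp: c_def)
  have cf: "c f = Suc (L f)" "c y = L f" using yf by (auto simp: c_def)
  have card: "card ?W = Suc (card A + card B)"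
    using fin f AB by (simp add: card_Un_disjoint)
  have rA: "l < L x" "L x \<le> l + card A" if "x \<in> A" for x using good_labelling_range[OF gA that] by auto
  have rB: "l + card A < L x" "L x \<le> l + card A + card B" if "x \<in> B" for x
    using good_labelling_range[OF gB that] by auto
  have injA: "inj_on L A" and injB: "inj_on L B"
    using good_labellingD(1)[OF gA] good_labellingD(1)[OF gB] by (auto simp: bij_betw_def)
  have lastA: "x = y" if "x \<in> A" "L x = l + card A" for x
    using inj_onD[OF injA _ that(1) y] that(2) Ly by simp
  have upA: "c x \<le> l + card A" if "x \<in> A" "x \<noteq> y" for x
    using good_labelling_upper[OF gA that(1)] lastA[OF that(1)] that cA by auto
  have lastB: "x \<in> Z" if x: "x \<in> B" and Lx: "L x = l + card A + card B" for x
  proof -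
    obtain z where z: "Z = {z}" "z \<in> B" using Z x by auto
    then show ?thesis using inj_onD[OF injB _ x z(2)] Lx Lz[of z] by simp
  qed
  have cZ: "c z = L f" if "z \<in> Z" for z
    using good_labelling_last(1)[OF gB, of z] Lz[OF that] cB[of z] Z that Lf by auto
  have upB: "c x \<le> l + card A + card B" if "x \<in> B" "x \<notin> Z" for x
    using good_labelling_upper[OF gB that(1)] lastB[OF that(1)] that cB by auto
  have ltA: "L x < c x" if "x \<in> A" "x \<noteq> y" for x
    using good_labellingD(2)[OF gA] that cA by simp
  have ltB: "L x < c x" if "x \<in> B" for x using good_labellingD(2)[OF gB] that cB by simp
  have bij: "bij_betw L ?W {l<..l + card ?W}"
  proof -
    have "bij_betw L (A \<union> B) ({l<..l + card A} \<union> {l + card A<..l + card A + card B})"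
      using good_labellingD(1)[OF gA] good_labellingD(1)[OF gB] by (intro bij_betw_combine) auto
    moreover have "bij_betw L {f} {Suc (l + card A + card B)}"
      using Lf by (simp add: bij_betw_def)
    ultimately have "bij_betw L (A \<union> B \<union> {f})
        ({l<..l + card A} \<union> {l + card A<..l + card A + card B} \<union> {Suc (l + card A + card B)})"
      by (rule bij_betw_combine) auto
    moreover have "{l<..l + card A} \<union> {l + card A<..l + card A + card B} \<union>
        {Suc (l + card A + card B)} = {l<..l + card ?W}"
      unfolding card by auto
    ultimately show ?thesis by simp
  qed
  \<comment> \<open>As \<open>f\<close> has the largest label, it can only be the secondary vertex
    of a 3-cycle, whose other vertices are then \<open>y\<close> and the root of \<open>B\<close>. A
    3-cycle avoiding \<open>f\<close> cannot meet both \<open>A\<close> and \<open>B\<close>, which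
    are joined by at most one edge.\<close>
  have cyc: "x = y \<and> z \<in> Z \<or> complementary_in Q A L x z \<or> complementary_in Q B L x z"
    if comp: "complementary_in Q ?W L x z" for x z
  proof -
    obtain w where w: "x \<in> ?W" "z \<in> ?W" "w \<in> ?W" "{x, z, w} \<in> three_cycles Q" "L x < L z" "L z < L w"
      using comp unfolding complementary_in_def by blast
    have ne: "x \<noteq> z" "x \<noteq> w" "z \<noteq> w" using w(5,6) by auto
    then have e: "edges Q x z > 0" "edges Q x w > 0" "edges Q z w > 0"
      using three_cycles_edges[OF w(4)] by auto
    note e' = e e[unfolded edges_sym[of Q x z] edges_sym[of Q x w] edges_sym[of Q z w]]
    have E: "\<And>w. w \<in> A \<Longrightarrow> edges Q f w > 0 \<Longrightarrow> w = y" "\<And>w. w \<in> B \<Longrightarrow> edges Q f w > 0 \<Longrightarrow> w \<in> Z"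
      "\<And>u w. u \<in> A \<Longrightarrow> w \<in> B \<Longrightarrow> edges Q u w > 0 \<Longrightarrow> u = y \<and> w \<in> Z"
      using ej unfolding edge_joined_def by (auto split: if_splits)
    have Z1: "u = v" if "u \<in> Z" "v \<in> Z" for u v using that Z by auto
    have "z \<noteq> f" "x \<noteq> f"
      using w Lf rA rB by (metis UnE insertE le_imp_less_Suc less_asym' less_le_trans not_less_iff_gr_or_eq trans_le_add1)+
    then have "x \<in> A \<union> B" "z \<in> A \<union> B" using w by auto
    show ?thesis
    proof (cases "w = f")
      case True
      then have "x = y \<or> x \<in> Z" "z = y \<or> z \<in> Z"
        using e' E \<open>x \<in> A \<union> B\<close> \<open>z \<in> A \<union> B\<close> by blast+
      moreover have "x \<noteq> z" using w(5) by auto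
      moreover have "\<not> (x \<in> Z \<and> z = y)"
      proof
        assume "x \<in> Z \<and> z = y"
        then have "x \<in> B" "z \<in> A" using Z y by auto
        then show False using rA(2)[of z] rB(1)[of x] w(5) by simp
      qed
      ultimately show ?thesis using Z1 by blast
    next
      case False
      then have "w \<in> A \<union> B" using w(3) by auto
      have "{x, z, w} \<subseteq> A \<or> {x, z, w} \<subseteq> B"
        using E(3) e' ne \<open>x \<in> A \<union> B\<close> \<open>z \<in> A \<union> B\<close> \<open>w \<in> A \<union> B\<close> Z1 by blast
      then show ?thesis using w unfolding complementary_in_def by auto
    qed
  qed
  have up: "complementary_in Q ?W L x z"
    if "complementary_in Q A L x z \<or> complementary_in Q B L x z" for x z
    using that unfolding complementary_in_def by blast
  have lt: "L x < c x" if "x \<in> ?W" for x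
    using that cf ltA ltB Lf rA[OF y] by (cases "x = y") auto
  have c1: "c x = Suc (L z)" if comp: "complementary_in Q ?W L x z" for x z
    using cyc[OF comp]
  proof (elim disjE conjE)
    assume "x = y" "z \<in> Z"
    then show ?thesis using cf Lz Lf by simp
  next
    assume a: "complementary_in Q A L x z"
    then have "x \<in> A" "x \<noteq> y"
      using good_labelling_last(2)[OF gA y Ly] unfolding complementary_in_def by blast+
    then show ?thesis using good_labellingD(3)[OF gA a] cA by simp
  next
    assume a: "complementary_in Q B L x z"
    then have "x \<in> B" unfolding complementary_in_def by blast
    then show ?thesis using good_labellingD(3)[OF gB a] cB by simp
  qed
  have c2: "c x = Suc (L x)" if x: "x \<in> ?W" and no: "\<nexists>z. complementary_in Q ?W L x z" for x
  proof -
    consider "x = f" | "x = y" | "x \<in> A" "x \<noteq> y" | "x \<in> B" using x by auto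
    then show ?thesis
    proof cases
      case 2
      have "B = {}"
      proof (rule ccontr)
        assume "B \<noteq> {}"
        then obtain z where z: "Z = {z}" "z \<in> B" using Z by auto
        then have "{f, y, z} \<in> three_cycles Q" using ej unfolding edge_joined_def by auto
        then have "{y, z, f} \<in> three_cycles Q" by (simp add: insert_commute)
        then have "complementary_in Q ?W L y z"
          using z y rB[OF z(2)] Ly Lf unfolding complementary_in_def by auto
        then show False using no 2 by blast
      qed
      then show ?thesis using 2 cf Lf Ly by simp
    next
      case 3
      then show ?thesis using good_labellingD(4)[OF gA] cA no up by metis
    next
      case 4
      then show ?thesis using good_labellingD(4)[OF gB] cB no up by metis
    qed (use cf in simp)
  qed
  \<comment> \<open>\<open>c f\<close> exceeds all labels and all other endpoints, so only the
    coincidence \<open>c x = L f\<close> is possible.\<close>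
  have edges_f: "edges Q f x = of_bool (c f = L x \<or> c x = L f \<or> c f = c x)" if "x \<in> A \<union> B" for x
  proof -
    have "L x \<le> l + card A + card B" using that rA rB by fastforce
    moreover have "c x = L f \<longleftrightarrow> x = y \<or> x \<in> Z"
      using that cf cZ upA upB Lf by (metis UnE add_leD1 not_less_eq_eq order_refl trans_le_add1)
    moreover have "c x \<le> L f"
      using that cf cZ upA upB Lf by (metis UnE le_SucI order_refl trans_le_add1)
    ultimately show ?thesis
      using ej that cf Lf yf Z f AB unfolding edge_joined_def by auto
  qed
  \<comment> \<open>Changing the endpoint of \<open>y\<close> affects no relation inside
    \<open>A\<close>: the old and the new value both exceed all labels of \<open>A\<close> and the
    endpoints of its other vertices.\<close>
  have edges_A: "edges Q x w = of_bool (c x = L w \<or> c w = L x \<or> c x = c w)"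
    if xw: "x \<in> A" "w \<in> A" "x \<noteq> w" for x w
  proof -
    have old: "edges Q x w = of_bool (cA x = L w \<or> cA w = L x \<or> cA x = cA w)"
      using good_labellingD(5)[OF gA xw] .
    have cy: "cA y = Suc (l + card A)" using good_labelling_last(1)[OF gA y Ly] .
    consider "x \<noteq> y" "w \<noteq> y" | "x = y" "w \<noteq> y" | "x \<noteq> y" "w = y" using xw(3) by blast
    then show ?thesis
    proof cases
      case 1
      then show ?thesis using old cA xw by simp
    next
      case 2
      then show ?thesis
        using old cA[of w] upA[of w] rA[OF xw(2)] cf cy Lf xw by auto
    next
      case 3
      then show ?thesis
        using old cA[of x] upA[of x] rA[OF xw(1)] cf cy Lf xw by auto
    qed
  qed
  have edges_B: "edges Q x w = of_bool (c x = L w \<or> c w = L x \<or> c x = c w)"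
    if "x \<in> B" "w \<in> B" "x \<noteq> w" for x w
    using good_labellingD(5)[OF gB that] that cB by simp
  \<comment> \<open>Endpoints of vertices of \<open>A\<close> lie below the labels of
    \<open>B\<close>, except that of \<open>y\<close>, which lies above them. The only possible
    coincidence is a common endpoint \<open>L f\<close>.\<close>
  have edges_AB: "edges Q x w = of_bool (c x = L w \<or> c w = L x \<or> c x = c w)"
    if x: "x \<in> A" and w: "w \<in> B" for x w
  proof -
    have old: "edges Q x w = of_bool (x = y \<and> w \<in> Z)"
      using ej that unfolding edge_joined_def by auto
    have "L x < L w" "L x < c w" using rA[OF x] rB[OF w] ltB[OF w] by auto
    moreover have "c x \<noteq> L w" "(c x = c w) = (x = y \<and> w \<in> Z)"
      using upA[OF x] upB[OF w] cZ[of w] rB[OF w] ltB[OF w] cf Lf by (cases "x = y"; cases "w \<in> Z"; force)+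
    ultimately show ?thesis unfolding old by simp
  qed
  have "edges Q x w = of_bool (c x = L w \<or> c w = L x \<or> c x = c w)"
    if x: "x \<in> ?W" and w: "w \<in> ?W" and ne: "x \<noteq> w" for x w
  proof -
    have sym: "edges Q x w = of_bool (c w = L x \<or> c x = L w \<or> c w = c x) \<Longrightarrow> ?thesis"
      by (simp add: disj_ac eq_commute)
    consider "x = f" "w \<in> A \<union> B" | "w = f" "x \<in> A \<union> B" | "x \<in> A" "w \<in> A" | "x \<in> B" "w \<in> B"
      | "x \<in> A" "w \<in> B" | "x \<in> B" "w \<in> A" using x w ne by auto
    then show ?thesis
    proof cases
      case 2
      then show ?thesis using edges_f[of x] edges_sym[of Q x w] by (intro sym) simp
    next
      case 6
      then show ?thesis using edges_AB[of w x] edges_sym[of Q x w] by (intro sym) simp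
    qed (use edges_f edges_A edges_B edges_AB ne in auto)
  qed
  then have "good_labelling Q ?W L l c"
    unfolding good_labelling_def using bij lt c1 c2 by blast
  then show ?thesis by blast
qed

section \<open>Following a run of the labelling procedure\<close>

text \<open>The content of a run at consecutive string vertices, each recursive run being replaced
  by the good labelling it produces. The \<open>branch\<close> premise is there because the
  induction over runs yields that labelling only for branches.\<close>

definition label_step :: "'v quiver \<Rightarrow> ('v \<Rightarrow> nat) \<Rightarrow> 'v \<Rightarrow> 'v \<Rightarrow> bool" where
  "label_step Q L u v \<longleftrightarrow>
     ((\<nexists>z. {u, v, z} \<in> three_cycles Q) \<longrightarrow> L v = L u + 1) \<and>
     (\<forall>z. {u, v, z} \<in> three_cycles Q \<longrightarrow>
        (let R = rooted_subquiver Q z u v in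
          (branch R {z} (verts R) \<longrightarrow>
            (\<exists>L' c. good_labelling R (verts R) L' 0 c \<and> L' z = card (verts R) \<and>
              (\<forall>w\<in>verts R. L w = L u + L' w))) \<and>
          L v = L u + card (verts R) + 1))"

text \<open>Here \<open>f # p\<close> is the reversed string, so the induction removes the last labelled vertex.\<close>

lemma labelled_branch:
  assumes "branch Q Y W"
  shows "Y = {f} \<Longrightarrow> W \<subseteq> verts Q \<Longrightarrow> \<forall>w\<in>W - {f}. \<forall>u. u \<notin> W \<longrightarrow> edges Q w u = 0 \<Longrightarrow>
    walk Q (f # p) \<Longrightarrow> set p \<subseteq> W \<Longrightarrow>
    \<forall>m. Suc m < length (f # p) \<longrightarrow> label_step Q L ((f # p) ! Suc m) ((f # p) ! m) \<Longrightarrow>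
    (p = [] \<longrightarrow> W = {f}) \<Longrightarrow> simplicial Q (last (f # p)) \<Longrightarrow> L (last (f # p)) = Suc l \<Longrightarrow>
    (\<exists>c. good_labelling Q W L l c) \<and> L f = l + card W"
  using assms
proof (induction arbitrary: f p rule: branch_edge_induct)
  case (node Y A Z B x f p)
  then have ej: "edge_joined Q f Y A Z B" by simp
  let ?W = "insert f (A \<union> B)"
  have W: "insert x (A \<union> B) = ?W" using node.prems(1) by simp
  note prems = node.prems[unfolded W]
  \<comment> \<open>The string continues into \<open>A\<close>, so \<open>B\<close> is the
    sub-branch labelled by a recursive call. The mirror case exchanges \<open>A\<close> and
    \<open>B\<close>.\<close>
  have grow: "(\<exists>c. good_labelling Q ?W L l c) \<and> L f = l + card ?W"
    if ej: "edge_joined Q f Y A Z B" and brA: "branch Q Y A" and brB: "branch Q Z B"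
      and IH: "\<And>y p. Y = {y} \<Longrightarrow> A \<subseteq> verts Q \<Longrightarrow>
        \<forall>w\<in>A - {y}. \<forall>u. u \<notin> A \<longrightarrow> edges Q w u = 0 \<Longrightarrow> walk Q (y # p) \<Longrightarrow> set p \<subseteq> A \<Longrightarrow>
        \<forall>m. Suc m < length (y # p) \<longrightarrow> label_step Q L ((y # p) ! Suc m) ((y # p) ! m) \<Longrightarrow>
        (p = [] \<longrightarrow> A = {y}) \<Longrightarrow> simplicial Q (last (y # p)) \<Longrightarrow> L (last (y # p)) = Suc l \<Longrightarrow>
        (\<exists>c. good_labelling Q A L l c) \<and> L y = l + card A"
      and p: "p \<noteq> []" "hd p \<in> Y" "set p \<subseteq> A" and W: "?W = insert f (A \<union> B)" for Y A Z B
  proof -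
    obtain y p' where y: "p = y # p'" "Y = {y}"
      using p(1,2) branch_root[OF brA] by (cases p) auto
    have yA: "y \<in> A" using p(3) y(1) by simp
    have f: "f \<notin> A" "f \<notin> B" "A \<inter> B = {}" using ej unfolding edge_joined_def by auto
    have closed: "edges Q w u = 0" if "w \<in> insert f (A \<union> B)" "w \<noteq> f" "u \<notin> insert f (A \<union> B)" for w u
      using prems(3) that unfolding W by auto
    have fA: "w = y" if "edges Q f w > 0" "w \<in> A" for w
      using ej that y(2) unfolding edge_joined_def by (auto split: if_splits)
    have fB: "w \<in> Z" if "edges Q f w > 0" "w \<in> B" for w
      using ej that unfolding edge_joined_def by (auto split: if_splits)
    have AB: "u = y \<and> w \<in> Z" if "edges Q u w > 0" "u \<in> A" "w \<in> B" for u w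
      using ej that y(2) unfolding edge_joined_def by (auto split: if_splits)
    have fy: "edges Q y f > 0" using ej yA y(2) edges_sym[of Q y f] unfolding edge_joined_def by auto
    have "(\<exists>c. good_labelling Q A L l c) \<and> L y = l + card A"
    proof (rule IH[OF y(2)])
      show "A \<subseteq> verts Q" using prems(2) W by auto
      show "\<forall>w\<in>A - {y}. \<forall>u. u \<notin> A \<longrightarrow> edges Q w u = 0"
      proof (intro ballI allI impI)
        fix w u assume w: "w \<in> A - {y}" and u: "u \<notin> A"
        consider "u = f" | "u \<in> B" | "u \<notin> insert f (A \<union> B)" using u by auto
        then show "edges Q w u = 0"
        proof cases
          case 1
          then show ?thesis using fA[of w] w edges_sym[of Q w f] by auto
        next
          case 2
          then show ?thesis using AB[of w u] w by auto
        next
          case 3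
          then show ?thesis using closed[of w u] w f by auto
        qed
      qed
      show "walk Q (y # p')" using prems(4) y(1) by (simp add: walk_Cons_Cons)
      show "set p' \<subseteq> A" using p(3) y(1) by simp
      show "\<forall>m. Suc m < length (y # p') \<longrightarrow> label_step Q L ((y # p') ! Suc m) ((y # p') ! m)"
      proof (intro allI impI)
        fix m assume "Suc m < length (y # p')"
        then show "label_step Q L ((y # p') ! Suc m) ((y # p') ! m)"
          using prems(6)[rule_format, of "Suc m"] y(1) by simp
      qed
      show simp: "simplicial Q (last (y # p'))" and "L (last (y # p')) = Suc l"
        using prems(8,9) y(1) by simp_all
      \<comment> \<open>Here \<open>y\<close> starts the string, so its neighbours are pairwise
        adjacent. As \<open>f\<close> is one of them, another neighbour in \<open>A\<close> would be
        adjacent to \<open>f\<close>, which sees only \<open>y\<close> in \<open>A\<close>.\<close>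
      show "p' = [] \<longrightarrow> A = {y}"
      proof (intro impI, rule ccontr)
        assume "p' = []" "A \<noteq> {y}"
        then obtain w where w: "w \<in> A - {y}" "edges Q y w > 0"
          using branch_has_neighbour brA y(2) by metis
        have "simplicial Q y" using simp \<open>p' = []\<close> by simp
        moreover have "f \<noteq> w" using w f by auto
        ultimately have "edges Q f w > 0" using fy w(2) unfolding simplicial_def by blast
        then show False using fA w by auto
      qed
    qed
    then obtain cA where cA: "good_labelling Q A L l cA" "L y = l + card A" by blast
    have noloop: "arr Q w w = 0" if "w \<in> insert f A" for w
      using that ej branch_no_loop[OF brA] unfolding edge_joined_def edges_def by auto
    \<comment> \<open>A common neighbour of \<open>y\<close> and \<open>f\<close> is not outside the
      branch, where \<open>y\<close> has no neighbours, nor in \<open>A\<close>, where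
      \<open>f\<close> sees only \<open>y\<close>; so it is the root of \<open>B\<close>.\<close>
    have third: "z \<in> Z" if z: "{y, f, z} \<in> three_cycles Q" for z
    proof -
      have "z \<noteq> y" "z \<noteq> f"
        using three_cycles_doubleton[of y f Q] z noloop[of y] noloop[of f] yA
        by (auto simp: insert_commute)
      then have e: "edges Q y z > 0" "edges Q f z > 0"
        using three_cycles_edges[OF z] by auto
      show ?thesis
        using e closed[of y z] fA[of z] fB[of z] \<open>z \<noteq> y\<close> \<open>z \<noteq> f\<close> yA f
        by (cases "z \<in> insert f (A \<union> B)") auto
    qed
    have step: "label_step Q L y f" using prems(6)[rule_format, of 0] y(1) by simp
    have "\<exists>cB. good_labelling Q B L (l + card A) cB \<and> (\<forall>z\<in>Z. L z = l + card A + card B) \<and>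
      L f = Suc (l + card A + card B)"
    proof (cases "B = {}")
      case True
      then have "Z = {}" using branch_root[OF brB] by auto
      then have "L f = L y + 1" using step third unfolding label_step_def by auto
      then show ?thesis
        using True \<open>Z = {}\<close> cA(2) by (auto intro!: exI good_labelling_empty)
    next
      case False
      then obtain z where z: "Z = {z}" "z \<in> B" using branch_root[OF brB] by auto
      have "{f, y, z} \<in> three_cycles Q" using ej y(2) z unfolding edge_joined_def by auto
      then have tri: "{y, f, z} \<in> three_cycles Q" by (simp add: insert_commute)
      have R: "rooted_subquiver Q z y f = full_subquiver Q B"
      proof (rule rooted_subquiver_branch)
        show "branch Q {z} B" using brB z by simp
        show "B \<subseteq> verts Q" using prems(2) W by auto
        show "y \<notin> B" "f \<notin> B" using f yA by auto
        show "w = y \<or> w = f" if "u \<in> B" "w \<notin> B" "edges Q u w > 0" for u w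
          using that closed[of u w] AB[of w u] edges_sym[of Q u w] f
          by (cases "w \<in> insert f (A \<union> B)") auto
      qed
      have vR: "verts (full_subquiver Q B) = B" by (simp add: full_subquiver_def)
      have "branch (full_subquiver Q B) {z} B"
        by (rule branch_cong[OF brB[unfolded z(1)]]) (simp add: full_subquiver_def)
      then obtain L' c where L': "good_labelling (full_subquiver Q B) B L' 0 c" "L' z = card B"
        "\<forall>w\<in>B. L w = L y + L' w" and Lf: "L f = L y + card B + 1"
        using step tri unfolding label_step_def Let_def R by (metis R vR)
      have "good_labelling Q B L (l + card A) (\<lambda>x. l + card A + c x)"
        by (rule good_labelling_full_subquiver[OF L'(1)]) (use L'(3) cA(2) in simp)
      moreover have "L z = l + card A + card B" using L'(2,3) z cA(2) by simp
      moreover have "L f = Suc (l + card A + card B)" using Lf cA(2) by simp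
      ultimately show ?thesis using z by auto
    qed
    then obtain cB where cB: "good_labelling Q B L (l + card A) cB"
      "\<And>z. z \<in> Z \<Longrightarrow> L z = l + card A + card B" "L f = Suc (l + card A + card B)" by blast
    have "\<exists>c. good_labelling Q (insert f (A \<union> B)) L l c"
    proof (rule good_labelling_join[OF _ _ _ yA _ cA cB])
      show "edge_joined Q f {y} A Z B" using ej y(2) by simp
      show "finite A" "finite B" using brA brB branch_finite by auto
      show "Z = {} \<and> B = {} \<or> (\<exists>z. Z = {z} \<and> z \<in> B)" using branch_root[OF brB] .
    qed
    moreover have "L f = l + card (insert f (A \<union> B))"
      using cB(3) f branch_finite[OF brA] branch_finite[OF brB] by (simp add: card_Un_disjoint)
    ultimately show ?thesis unfolding W by blast
  qed
  show ?case
  proof (cases "p = []")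
    case True
    then have W': "?W = {f}" and "L f = Suc l" using prems(7,9) by auto
    then show ?thesis unfolding W W' by (auto intro!: exI good_labelling_singleton)
  next
    case False
    have "p = [] \<or> (hd p \<in> Y \<and> set p \<subseteq> A) \<or> (hd p \<in> Z \<and> set p \<subseteq> B)"
    proof (rule walk_side[OF ej _ _ _ _ prems(4,5)])
      show "Y = {} \<or> (\<exists>y. Y = {y})" "Z = {} \<or> (\<exists>z. Z = {z})"
        using branch_root[OF node.hyps(1)] branch_root[OF node.hyps(2)] by auto
      show "y \<notin> set p" if "Y = {y}" "walk Q (y # p)" "set p \<subseteq> A" for y p
        using walk_induced[OF node.hyps(1) that] by simp
      show "z \<notin> set p" if "Z = {z}" "walk Q (z # p)" "set p \<subseteq> B" for z p
        using walk_induced[OF node.hyps(2) that] by simp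
    qed
    with False have "hd p \<in> Y \<and> set p \<subseteq> A \<or> hd p \<in> Z \<and> set p \<subseteq> B" by simp
    then show ?thesis
      unfolding W
    proof
      assume "hd p \<in> Y \<and> set p \<subseteq> A"
      then show "(\<exists>c. good_labelling Q ?W L l c) \<and> L f = l + card ?W"
        using False by (intro grow[OF ej node.hyps(1,2) node.IH(1)]) auto
    next
      assume "hd p \<in> Z \<and> set p \<subseteq> B"
      then show "(\<exists>c. good_labelling Q ?W L l c) \<and> L f = l + card ?W"
        using False
        by (intro grow[OF edge_joined_commute[OF ej] node.hyps(2,1) node.IH(2)]) auto
    qed
  qed
qed simp

text \<open>A recursive run uses a pair whose second vertex is the complementary vertex
  \<open>z\<close>, the root of its sub-branch. Rooting the branch at the second vertex of the pair
  is thus a hypothesis that recursion reproduces.\<close>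

lemma type_A_labelling_good:
  assumes "type_A_labelling Q e f L"
  shows "(\<And>x y. arr Q x y > 0 \<Longrightarrow> x \<in> verts Q \<and> y \<in> verts Q) \<Longrightarrow> branch Q {f} (verts Q) \<Longrightarrow>
    (\<exists>c. good_labelling Q (verts Q) L 0 c) \<and> L f = card (verts Q)"
  using assms
proof (induction rule: type_A_labelling.induct)
  case (single Q v L)
  then show ?case using good_labelling_singleton[of L v 0 Q] by auto
next
  case (string Q e f p L)
  have s: "p \<noteq> []" "hd p = e" "last p = f" "set p \<subseteq> verts Q" "walk Q p"
    using string.hyps(6) by (auto simp: string_from_to_walk)
  have noloop: "arr Q x x = 0" for x
    using branch_no_loop[OF string.prems(2)] string.prems(1)[of x x] by blast
  obtain q where q: "rev p = f # q" using s by (metis hd_rev list.collapse rev_is_Nil_conv)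
  have lq: "last (f # q) = e" using s q by (metis last_rev)
  have wq: "walk Q (f # q)" using walk_rev[OF s(5)] q by simp
  have sq: "set q \<subseteq> verts Q" using s(4) q by (metis set_rev set_subset_Cons subset_trans)
  have ind: "induced Q (rev p)" using walk_induced[OF string.prems(2) refl wq sq] q by simp
  \<comment> \<open>The branch is rooted at \<open>f\<close>, where the string ends, so the absence
    of chords is proved for the reversed string and turned back.\<close>
  have dist: "p ! i \<noteq> p ! j \<and> (edges Q (p ! i) (p ! j) > 0 \<longrightarrow> j = Suc i)"
    if "i < j" "j < length p" for i j
  proof -
    have "rev p ! (length p - Suc j) = p ! j" "rev p ! (length p - Suc i) = p ! i"
      using that by (auto simp: rev_nth)
    moreover have "length p - Suc j < length p - Suc i" "length p - Suc i < length (rev p)"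
      using that by auto
    ultimately have "p ! j \<noteq> p ! i"
      "edges Q (p ! j) (p ! i) > 0 \<longrightarrow> length p - Suc i = Suc (length p - Suc j)"
      using induced_nth[OF ind] by metis+
    then show ?thesis using that edges_sym[of Q "p ! i" "p ! j"] by auto
  qed
  \<comment> \<open>\<open>pcs_rel\<close> admits any two positions on the string. Without chords
    these must be consecutive, and the third vertex of a triangle on them cannot lie on the
    string.\<close>
  have pcs: "pcs_rel Q p (p ! m) z y \<longleftrightarrow> y = p ! Suc m \<and> {p ! m, y, z} \<in> three_cycles Q"
    if m: "Suc m < length p" for m z y
  proof
    assume a: "pcs_rel Q p (p ! m) z y"
    then obtain i j where ij: "i < j" "j < length p" "p ! i = p ! m" "p ! j = y"
      and tri: "{p ! m, y, z} \<in> three_cycles Q" unfolding pcs_rel_def by blast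
    have "i = m" using dist[of i m] dist[of m i] ij m by (metis Suc_lessD less_trans linorder_neqE_nat)
    moreover have "edges Q (p ! m) y > 0"
      using three_cycles_edges[OF tri] dist[OF ij(1,2)] ij by auto
    ultimately show "y = p ! Suc m \<and> {p ! m, y, z} \<in> three_cycles Q"
      using dist[OF ij(1,2)] ij tri by auto
  next
    assume "y = p ! Suc m \<and> {p ! m, y, z} \<in> three_cycles Q"
    then have y: "y = p ! Suc m" and tri: "{p ! m, p ! Suc m, z} \<in> three_cycles Q" by auto
    have z: "z \<noteq> p ! m" "z \<noteq> p ! Suc m"
      using three_cycles_doubleton[of "p ! m" "p ! Suc m" Q] tri noloop
      by (auto simp: insert_commute)
    then have e: "edges Q (p ! m) z > 0" "edges Q z (p ! m) > 0"
      "edges Q (p ! Suc m) z > 0" "edges Q z (p ! Suc m) > 0"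
      using three_cycles_edges[OF tri] by auto
    have "z \<notin> set p"
    proof
      assume "z \<in> set p"
      then obtain k where k: "k < length p" "p ! k = z" by (metis in_set_conv_nth)
      then have "k \<noteq> m" "k \<noteq> Suc m" using z by auto
      then consider "k < m" | "k > Suc m" by linarith
      then show False
      proof cases
        case 1
        then show False using dist[of k "Suc m"] e(4) k m by auto
      next
        case 2
        then show False using dist[of m k] e(1) k m by auto
      qed
    qed
    then show "pcs_rel Q p (p ! m) z y" using tri y m unfolding pcs_rel_def by auto
  qed
  have "(\<exists>c. good_labelling Q (verts Q) L 0 c) \<and> L f = 0 + card (verts Q)"
  proof (rule labelled_branch[OF string.prems(2) refl _ _ wq sq])
    show "\<forall>w\<in>verts Q - {f}. \<forall>u. u \<notin> verts Q \<longrightarrow> edges Q w u = 0"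
      using string.prems(1) by (auto simp: edges_def)
    show "q = [] \<longrightarrow> verts Q = {f}" using lq string.hyps(5) by auto
    show "simplicial Q (last (f # q))"
      unfolding lq using string.hyps(1,3) string.prems(1) noloop
      by (intro end_vertex_simplicial)
    show "L (last (f # q)) = Suc 0" unfolding lq using string.hyps(7) by simp
    show "\<forall>m. Suc m < length (f # q) \<longrightarrow> label_step Q L ((f # q) ! Suc m) ((f # q) ! m)"
    proof (intro allI impI)
      fix m assume m: "Suc m < length (f # q)"
      have "length (f # q) = length p" using q by (metis length_rev)
      define j where "j = length p - Suc (Suc m)"
      have j: "(f # q) ! m = p ! Suc j" "(f # q) ! Suc m = p ! j" "Suc j < length p"
        using m \<open>length (f # q) = length p\<close> unfolding q[symmetric]
        by (auto simp: rev_nth j_def Suc_diff_Suc)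
      have no: "L (p ! Suc j) = L (p ! j) + 1" if none: "\<nexists>z. {p ! j, p ! Suc j, z} \<in> three_cycles Q"
      proof -
        have "\<nexists>z y. pcs_rel Q p (p ! j) z y" using none unfolding pcs[OF j(3)] by simp
        then show ?thesis using string.hyps(8) j(3) by simp
      qed
      have yes: "(let R = rooted_subquiver Q z (p ! j) (p ! Suc j) in
          (branch R {z} (verts R) \<longrightarrow>
            (\<exists>L' c. good_labelling R (verts R) L' 0 c \<and> L' z = card (verts R) \<and>
              (\<forall>w\<in>verts R. L w = L (p ! j) + L' w))) \<and>
          L (p ! Suc j) = L (p ! j) + card (verts R) + 1)"
        if tri: "{p ! j, p ! Suc j, z} \<in> three_cycles Q" for z
      proof -
        let ?R = "rooted_subquiver Q z (p ! j) (p ! Suc j)"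
        have "pcs_rel Q p (p ! j) z (p ! Suc j)" using pcs[OF j(3)] tri by blast
        from string.IH[rule_format, OF j(3) this]
        obtain L' where L': "(\<And>x y. arr ?R x y > 0 \<Longrightarrow> x \<in> verts ?R \<and> y \<in> verts ?R) \<Longrightarrow>
            branch ?R {z} (verts ?R) \<Longrightarrow>
            (\<exists>c. good_labelling ?R (verts ?R) L' 0 c) \<and> L' z = card (verts ?R)"
          "\<forall>v\<in>verts ?R. L v = L (p ! j) + L' v"
          and n: "L (p ! Suc j) = L (p ! j) + card (verts ?R) + 1" by blast
        have "x \<in> verts ?R \<and> y \<in> verts ?R" if "arr ?R x y > 0" for x y
          using that by (auto simp: rooted_subquiver_def full_subquiver_def split: if_splits)
        then show ?thesis unfolding Let_def using L' n by blast
      qed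
      show "label_step Q L ((f # q) ! Suc m) ((f # q) ! m)"
        unfolding label_step_def j using no yes by blast
    qed
  qed simp
  then show ?case by simp
qed

section \<open>Roots of type D\<close>

lemma dynkin_D_chain:
  "i \<le> n - 2 \<Longrightarrow> j \<le> n - 2 \<Longrightarrow> 1 \<le> i \<Longrightarrow> 1 \<le> j \<Longrightarrow>
    {i, j} \<in> dynkin_D n \<longleftrightarrow> j = Suc i \<or> i = Suc j"
  unfolding dynkin_D_def by (auto simp: doubleton_eq_iff)

lemma dynkin_D_fork:
  assumes "n \<ge> 3" "1 \<le> i" "i \<le> n - 2" "m = n - 1 \<or> m = n"
  shows "{i, m} \<in> dynkin_D n \<longleftrightarrow> i = n - 2"
  using assms unfolding dynkin_D_def by (auto simp: doubleton_eq_iff)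

lemma dynkin_D_tips: "n \<ge> 3 \<Longrightarrow> {n - 1, n} \<notin> dynkin_D n"
  unfolding dynkin_D_def by (auto simp: doubleton_eq_iff)

locale type_D_roots =
  fixes n :: nat and \<alpha> :: "nat \<Rightarrow> 'e::real_inner" and \<Phi> :: "'e set"
  assumes n: "n \<ge> 3" and rs: "root_system_of_type n (dynkin_D n) \<alpha> \<Phi>"
begin

lemma norm_root: "\<beta> \<in> \<Phi> \<Longrightarrow> \<beta> \<bullet> \<beta> = 2"
  using rs by (simp add: root_system_of_type_def)

lemma simple_root: "i \<in> {1..n} \<Longrightarrow> \<alpha> i \<in> \<Phi>"
  using rs by (auto simp: root_system_of_type_def simple_system_def)

lemma reflect_root: "\<beta> \<in> \<Phi> \<Longrightarrow> \<gamma> \<in> \<Phi> \<Longrightarrow> \<beta> - (\<beta> \<bullet> \<gamma>) *\<^sub>R \<gamma> \<in> \<Phi>"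
proof -
  assume "\<beta> \<in> \<Phi>" "\<gamma> \<in> \<Phi>"
  then have "\<beta> - cartan_number \<beta> \<gamma> *\<^sub>R \<gamma> \<in> \<Phi>" "cartan_number \<beta> \<gamma> = \<beta> \<bullet> \<gamma>"
    using rs norm_root by (auto simp: root_system_of_type_def root_system_def cartan_number_def)
  then show ?thesis by simp
qed

lemma inner_simple:
  assumes "i \<in> {1..n}" "j \<in> {1..n}"
  shows "\<alpha> i \<bullet> \<alpha> j = (if i = j then 2 else if {i, j} \<in> dynkin_D n then - 1 else 0)"
proof (cases "i = j")
  case False
  have "cartan_number (\<alpha> i) (\<alpha> j) = \<alpha> i \<bullet> \<alpha> j"
    using norm_root[OF simple_root[OF assms(2)]] by (simp add: cartan_number_def)
  moreover have "cartan_number (\<alpha> i) (\<alpha> j) = (if {i, j} \<in> dynkin_D n then - 1 else 0)"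
    using rs assms False unfolding root_system_of_type_def by blast
  ultimately show ?thesis using False by simp
qed (use norm_root[OF simple_root[OF assms(1)]] in simp)

lemma inner_chain:
  "1 \<le> i \<Longrightarrow> i \<le> n - 2 \<Longrightarrow> 1 \<le> j \<Longrightarrow> j \<le> n - 2 \<Longrightarrow>
    \<alpha> i \<bullet> \<alpha> j = 2 * of_bool (i = j) - of_bool (j = Suc i) - of_bool (i = Suc j)"
  using inner_simple[of i j] dynkin_D_chain[of i n j] by auto

lemma inner_fork:
  "1 \<le> i \<Longrightarrow> i \<le> n - 2 \<Longrightarrow> m = n - 1 \<or> m = n \<Longrightarrow> \<alpha> i \<bullet> \<alpha> m = - of_bool (i = n - 2)"
  using inner_simple[of i m] dynkin_D_fork[OF n, of i m] n by auto

text \<open>For \<open>j \<le> n - 1\<close> this is eps i - eps j in coordinates; the half-open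
  range makes the second index equal to \<open>c x\<close>.\<close>

definition seg :: "nat \<Rightarrow> nat \<Rightarrow> 'e" where
  "seg i j = (\<Sum>t = i..<j. \<alpha> t)"

lemma seg_refl: "seg i i = 0"
  by (simp add: seg_def)

lemma seg_Suc: "i \<le> j \<Longrightarrow> seg i (Suc j) = seg i j + \<alpha> j"
  by (simp add: seg_def)

lemma inner_seg_simple:
  assumes "1 \<le> i" "i \<le> j" "j \<le> n - 1" "1 \<le> t" "t \<le> n - 2"
  shows "seg i j \<bullet> \<alpha> t =
    of_bool (i = t) - of_bool (i = Suc t) - of_bool (j = t) + of_bool (j = Suc t)"
  using assms(2,3)
proof (induction rule: dec_induct)
  case base
  then show ?case by (simp add: seg_refl)
next
  case (step j)
  then have "\<alpha> j \<bullet> \<alpha> t = 2 * of_bool (j = t) - of_bool (t = Suc j) - of_bool (j = Suc t)"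
    using assms by (intro inner_chain) auto
  then show ?case using step by (auto simp: seg_Suc inner_add_left)
qed

text \<open>The right-hand side is the inner product of eps i - eps j and eps i' - eps j' for
  orthonormal eps, here derived from the chain part of the Cartan matrix.\<close>

lemma inner_seg_seg:
  assumes "1 \<le> i" "i \<le> j" "j \<le> n - 1" "1 \<le> i'" "i' \<le> j'" "j' \<le> n - 1"
  shows "seg i j \<bullet> seg i' j' =
    of_bool (i = i') - of_bool (i = j') - of_bool (j = i') + of_bool (j = j')"
  using assms(5,6)
proof (induction rule: dec_induct)
  case base
  then show ?case by (simp add: seg_refl)
next
  case (step j')
  then have "seg i j \<bullet> \<alpha> j' =
      of_bool (i = j') - of_bool (i = Suc j') - of_bool (j = j') + of_bool (j = Suc j')"
    using assms by (intro inner_seg_simple) auto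
  then show ?case using step by (simp add: seg_Suc inner_add_right)
qed

text \<open>Of the chain only node n-2 is joined to the tips, and a nonempty segment contains it
  exactly when it ends at n-1.\<close>

lemma inner_seg_fork:
  assumes "1 \<le> i" "i \<le> j" "j \<le> n - 1" "m = n - 1 \<or> m = n"
  shows "seg i j \<bullet> \<alpha> m = - of_bool (i < j \<and> j = n - 1)"
  using assms(2,3)
proof (induction rule: dec_induct)
  case base
  then show ?case by (simp add: seg_refl)
next
  case (step j)
  then have "\<alpha> j \<bullet> \<alpha> m = - of_bool (j = n - 2)"
    using assms by (intro inner_fork) auto
  then show ?case using step by (auto simp: seg_Suc inner_add_left)
qed

text \<open>Appending \<alpha> j to a segment ending before it is the reflection in \<alpha> j, as
  their inner product is -1.\<close>

lemma seg_root:
  assumes "1 \<le> i" "Suc i \<le> j" "j \<le> n - 1"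
  shows "seg i j \<in> \<Phi>"
  using assms(2,3)
proof (induction rule: dec_induct)
  case base
  then show ?case using simple_root[of i] assms by (simp add: seg_Suc seg_refl)
next
  case (step j)
  have "seg i j \<bullet> \<alpha> j = - 1" using inner_seg_simple[of i j j] step assms by auto
  moreover have "seg i j - (seg i j \<bullet> \<alpha> j) *\<^sub>R \<alpha> j \<in> \<Phi>"
    using step simple_root[of j] by (intro reflect_root) auto
  ultimately show ?case using step by (simp add: seg_Suc)
qed

lemma int_span_le_span: "int_mod.span S \<subseteq> span (S :: 'e set)"
  by (rule int_mod.span_minimal)
    (auto simp: int_mod.subspace_def intro: span_base span_zero span_add span_scale)

text \<open>Independence: over the reals, \<open>\<gamma> ` V\<close> spans the \<open>n\<close>-dimensional space of the simple roots and
  has only \<open>n\<close> elements.\<close>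

lemma integral_basis:
  assumes \<gamma>: "\<gamma> ` V \<subseteq> \<Phi>" "inj_on \<gamma> V" "finite V" "card V = n"
    and sp: "\<And>i. i \<in> {1..n} \<Longrightarrow> \<alpha> i \<in> int_mod.span (\<gamma> ` V)"
  shows "int_mod.independent (\<gamma> ` V)" and "int_mod.span (\<gamma> ` V) = int_mod.span \<Phi>"
proof -
  let ?S = "\<gamma> ` V"
  have card: "finite ?S" "card ?S = n" using \<gamma> by (auto simp: card_image)
  have ss: "simple_system n \<alpha> \<Phi>" using rs by (simp add: root_system_of_type_def)
  have "\<Phi> \<subseteq> int_mod.span ?S"
  proof
    fix \<beta> assume "\<beta> \<in> \<Phi>"
    then obtain c :: "nat \<Rightarrow> int" where "\<beta> = (\<Sum>i = 1..n. of_int (c i) *\<^sub>R \<alpha> i)"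
      using ss unfolding simple_system_def by blast
    then show "\<beta> \<in> int_mod.span ?S"
      using sp by (auto intro!: int_mod.span_sum int_mod.span_scale)
  qed
  then have "int_mod.span \<Phi> \<subseteq> int_mod.span ?S"
    by (rule int_mod.span_minimal[OF _ int_mod.subspace_span])
  then show "int_mod.span ?S = int_mod.span \<Phi>" using int_mod.span_mono[OF \<gamma>(1)] by blast
  have "independent ?S"
  proof
    assume "dependent ?S"
    then obtain s where s: "s \<in> ?S" "s \<in> span (?S - {s})" unfolding dependent_def by blast
    then have "span ?S = span (?S - {s})" by (metis insert_Diff span_redundant)
    moreover have "\<alpha> ` {1..n} \<subseteq> span ?S" using sp int_span_le_span by blast
    moreover have "independent (\<alpha> ` {1..n})" using ss by (simp add: simple_system_def)
    ultimately have "card (\<alpha> ` {1..n}) \<le> card (?S - {s})"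
      using independent_span_bound[of "?S - {s}"] card(1) by auto
    moreover have "card (\<alpha> ` {1..n}) = n" using ss by (simp add: simple_system_def card_image)
    moreover have "card (?S - {s}) < n" using s(1) card by (metis card_Diff1_less)
    ultimately show False by simp
  qed
  show "int_mod.independent ?S"
  proof
    assume "int_mod.dependent ?S"
    then obtain t u where tu: "finite t" "t \<subseteq> ?S" "(\<Sum>v\<in>t. of_int (u v) *\<^sub>R v) = 0" "\<exists>v\<in>t. u v \<noteq> 0"
      unfolding int_mod.dependent_explicit by blast
    then have "dependent ?S"
      unfolding dependent_explicit by (intro exI[of _ t] exI[of _ "\<lambda>v. of_int (u v)"]) auto
    with \<open>independent ?S\<close> show False by simp
  qed
qed

end

theorem theorem4p2:
  fixes n :: nat
    and \<Gamma> \<Gamma>1 :: "'v quiver" and v1 a b :: 'v and L :: "'v \<Rightarrow> nat"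
    and \<Phi> :: "'e::real_inner set" and \<alpha> :: "nat \<Rightarrow> 'e"
  assumes "n \<ge> 4"
    and "mutation_type n (dynkin_D n) \<Gamma>"
    and "type_I_quiver n \<Gamma> \<Gamma>1 v1 a b"
    and "type_I_labelling n \<Gamma>1 v1 a b L"
    and "root_system_of_type n (dynkin_D n) \<alpha> \<Phi>"
  shows "companion_basis \<Phi> \<Gamma> (beta \<alpha> \<Gamma>1 L)"
proof -
  interpret type_D_roots n \<alpha> \<Phi> using assms by unfold_locales auto
  let ?V = "verts \<Gamma>1" and ?\<beta> = "beta \<alpha> \<Gamma>1 L"
  obtain \<Gamma>0 where mt: "mutation_type (n - 2) (dynkin_A (n - 2)) \<Gamma>1" and ev: "end_vertex \<Gamma>1 v1"
    and core: "type_I_core a b v1 \<Gamma>0" and meet: "verts \<Gamma>0 \<inter> ?V = {v1}" and glue: "\<Gamma> = glue \<Gamma>0 \<Gamma>1"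
    using assms(3) unfolding type_I_quiver_def by blast
  obtain e where lab: "type_A_labelling \<Gamma>1 e v1 L"
    and Lab: "L a = n - 1 \<and> L b = n \<or> L a = n \<and> L b = n - 1"
    using assms(4) unfolding type_I_labelling_def by blast
  have shape: "type_A_shape \<Gamma>1" and cardV: "card ?V = n - 2"
    using mutation_type_A_shape[OF mt] assms(1) by auto
  have supp: "x \<in> ?V \<and> y \<in> ?V" if "arr \<Gamma>1 x y > 0" for x y
    using shape that unfolding type_A_shape_def by blast
  have br: "branch \<Gamma>1 {v1} ?V" using end_vertex_branch[OF shape ev] .
  obtain c where g: "good_labelling \<Gamma>1 ?V L 0 c" and Lv1: "L v1 = n - 2"
    using type_A_labelling_good[OF lab supp br] cardV by auto
  have finV: "finite ?V" using branch_finite[OF br] .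
  have v1: "v1 \<in> ?V" using meet by auto
  have ab: "a \<notin> ?V" "b \<notin> ?V" "a \<noteq> b" "verts \<Gamma>0 = {a, b, v1}"
    using core meet unfolding type_I_core_def by auto
  have bij: "bij_betw L ?V {0<..n - 2}" using good_labellingD(1)[OF g] cardV by simp
  have inj: "inj_on L ?V" using bij by (simp add: bij_betw_def)
  have Lr: "1 \<le> L x" "L x \<le> n - 2" if "x \<in> ?V" for x
    using good_labelling_range[OF g that] cardV by auto
  have cr: "L x < c x" "c x \<le> n - 1" "c x = n - 1 \<longleftrightarrow> x = v1" if x: "x \<in> ?V" for x
  proof -
    show "L x < c x" using good_labellingD(2)[OF g x] .
    have "L x = n - 2 \<longleftrightarrow> x = v1" using Lv1 inj_onD[OF inj _ x v1] by auto
    then show "c x \<le> n - 1" "c x = n - 1 \<longleftrightarrow> x = v1"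
      using good_labelling_last(1)[OF g x] good_labelling_upper[OF g x] cardV assms(1) by auto
  qed
  have comp: "complementary_to \<Gamma>1 L x z \<longleftrightarrow> complementary_in \<Gamma>1 ?V L x z" for x z
  proof -
    have "C \<subseteq> ?V" if "C \<in> three_cycles \<Gamma>1" for C
      using that supp unfolding three_cycles_def by blast
    then show ?thesis unfolding complementary_to_def complementary_in_def by blast
  qed
  have \<beta>V: "?\<beta> x = seg (L x) (c x)" if x: "x \<in> ?V" for x
  proof (cases "\<exists>z. complementary_to \<Gamma>1 L x z")
    case True
    then obtain z where z: "complementary_to \<Gamma>1 L x z" by blast
    have cz: "c x = Suc (L w)" "w \<in> ?V" if "complementary_to \<Gamma>1 L x w" for w
      using that good_labellingD(3)[OF g] unfolding comp by (auto simp: complementary_in_def)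
    \<comment> \<open>Every complementary vertex of \<open>x\<close> has label
      \<open>c x - 1\<close>, so injectivity of \<open>L\<close> gives uniqueness.\<close>
    have "(THE z. complementary_to \<Gamma>1 L x z) = z"
      using z cz inj_onD[OF inj] by (intro the_equality) (auto, metis nat.inject)
    then show ?thesis
      using z cz[OF z] unfolding beta_def primary_vertex_def seg_def
      by (auto simp: atLeastLessThanSuc_atLeastAtMost)
  next
    case False
    then have "c x = Suc (L x)" using good_labellingD(4)[OF g x] comp by simp
    then show ?thesis using False by (simp add: beta_def primary_vertex_def seg_Suc seg_refl)
  qed
  have \<beta>o: "?\<beta> x = \<alpha> (L x)" if "x \<notin> ?V" for x
    using that comp unfolding beta_def primary_vertex_def complementary_in_def by auto
  have vG: "verts \<Gamma> = insert a (insert b ?V)" using glue ab v1 by (auto simp: glue_def)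
  have E: "edges \<Gamma> x y = edges \<Gamma>0 x y + edges \<Gamma>1 x y" for x y
    by (simp add: glue glue_def edges_def)
  have E1: "edges \<Gamma>1 x y = 0" if "x \<notin> ?V" for x y
    using supp[of x y] supp[of y x] that by (auto simp: edges_def)
  have q0: "is_quiver \<Gamma>0" using core by (simp add: type_I_core_def)
  have E0: "edges \<Gamma>0 x y = 0" if "x \<in> ?V" "x \<noteq> v1" for x y
  proof -
    have "x \<notin> verts \<Gamma>0" using that meet by auto
    then have "arr \<Gamma>0 x y = 0" "arr \<Gamma>0 y x = 0" using q0 unfolding is_quiver_def by blast+
    then show ?thesis by (simp add: edges_def)
  qed
  have EV: "\<bar>?\<beta> x \<bullet> ?\<beta> y\<bar> = real (edges \<Gamma> x y)" if xy: "x \<in> ?V" "y \<in> ?V" "x \<noteq> y" for x y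
  proof -
    have "edges \<Gamma>0 x y = 0"
      using E0[of x y] E0[of y x] xy edges_sym[of \<Gamma>0 x y] by (cases "x = v1") auto
    then have "edges \<Gamma> x y = of_bool (c x = L y \<or> c y = L x \<or> c x = c y)"
      using E good_labellingD(5)[OF g xy] by simp
    \<comment> \<open>As the labels differ and each start is below its endpoint, at most one of the
      three remaining coincidences occurs; nothing cancels, and the inner product is 0, 1 or
      -1.\<close>
    moreover have "L x \<noteq> L y" using inj_onD[OF inj _ xy(1,2)] xy(3) by blast
    moreover have "seg (L x) (c x) \<bullet> seg (L y) (c y) = of_bool (L x = L y) - of_bool (L x = c y)
        - of_bool (c x = L y) + of_bool (c x = c y)"
      using Lr[OF xy(1)] Lr[OF xy(2)] cr[OF xy(1)] cr[OF xy(2)] by (intro inner_seg_seg) auto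
    ultimately show ?thesis
      unfolding \<beta>V[OF xy(1)] \<beta>V[OF xy(2)] using cr(1)[OF xy(1)] cr(1)[OF xy(2)] by auto
  qed
  have Et: "?\<beta> x \<bullet> ?\<beta> t = - of_bool (x = v1)" "edges \<Gamma> x t = of_bool (x = v1)"
    if x: "x \<in> ?V" and t: "t = a \<or> t = b" for x t
  proof -
    have m: "L t = n - 1 \<or> L t = n" and tV: "t \<notin> ?V" using t Lab ab by auto
    show "?\<beta> x \<bullet> ?\<beta> t = - of_bool (x = v1)"
      unfolding \<beta>V[OF x] \<beta>o[OF tV]
      using inner_seg_fork[OF _ _ _ m, of "L x" "c x"] Lr[OF x] cr[OF x] by auto
    have "edges \<Gamma>0 v1 t = 1" using core t by (auto simp: type_I_core_def)
    then show "edges \<Gamma> x t = of_bool (x = v1)"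
      using E0[OF x] E1[OF tV, of x] unfolding E edges_sym[of \<Gamma>1 x t] by auto
  qed
  have Eab: "?\<beta> a \<bullet> ?\<beta> b = 0" "edges \<Gamma> a b = 0"
  proof -
    have "\<alpha> (n - 1) \<bullet> \<alpha> n = 0" "\<alpha> n \<bullet> \<alpha> (n - 1) = 0"
      using inner_simple[of "n - 1" n] dynkin_D_tips[OF n] n by (auto simp: inner_commute)
    then show "?\<beta> a \<bullet> ?\<beta> b = 0" using Lab \<beta>o ab by auto
    show "edges \<Gamma> a b = 0" using E E1[OF ab(1)] core by (simp add: type_I_core_def)
  qed
  have comm: "\<bar>?\<beta> y \<bullet> ?\<beta> x\<bar> = real (edges \<Gamma> y x)" if "\<bar>?\<beta> x \<bullet> ?\<beta> y\<bar> = real (edges \<Gamma> x y)" for x y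
    using that by (simp add: inner_commute edges_sym)
  have Evt: "\<bar>?\<beta> x \<bullet> ?\<beta> t\<bar> = real (edges \<Gamma> x t)" if "x \<in> ?V" "t = a \<or> t = b" for x t
    using Et[OF that] by simp
  have Eabs: "\<bar>?\<beta> a \<bullet> ?\<beta> b\<bar> = real (edges \<Gamma> a b)" using Eab by simp
  have edge: "\<bar>?\<beta> x \<bullet> ?\<beta> y\<bar> = real (edges \<Gamma> x y)"
    if x: "x \<in> verts \<Gamma>" and y: "y \<in> verts \<Gamma>" and ne: "x \<noteq> y" for x y
  proof -
    consider "x \<in> ?V" "y \<in> ?V" | "x \<in> ?V" "y = a \<or> y = b" | "y \<in> ?V" "x = a \<or> x = b"
      | "x = a" "y = b" | "x = b" "y = a"
      using x y ne unfolding vG by blast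
    then show ?thesis
    proof cases
      case 1
      then show ?thesis using EV ne by blast
    next
      case 2
      then show ?thesis by (rule Evt)
    next
      case 3
      then show ?thesis by (rule comm[OF Evt])
    next
      case 4
      then show ?thesis using Eabs by simp
    next
      case 5
      then show ?thesis using comm[OF Eabs] by simp
    qed
  qed
  have roots: "?\<beta> ` verts \<Gamma> \<subseteq> \<Phi>"
  proof
    fix r assume "r \<in> ?\<beta> ` verts \<Gamma>"
    then obtain x where x: "r = ?\<beta> x" "x \<in> ?V \<or> x \<notin> ?V \<and> (L x = n - 1 \<or> L x = n)"
      using Lab ab unfolding vG by auto
    from x(2) show "r \<in> \<Phi>"
    proof
      assume "x \<in> ?V"
      then show ?thesis using seg_root[of "L x" "c x"] Lr cr \<beta>V x(1) by (simp add: Suc_le_eq)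
    next
      assume "x \<notin> ?V \<and> (L x = n - 1 \<or> L x = n)"
      then show ?thesis using simple_root[of "L x"] \<beta>o x(1) n by auto
    qed
  qed
  \<comment> \<open>Equal roots would have inner product 2, whereas two vertices are joined by at
    most one edge.\<close>
  have injG: "inj_on ?\<beta> (verts \<Gamma>)"
  proof (rule inj_onI, rule ccontr)
    fix x y assume xy: "x \<in> verts \<Gamma>" "y \<in> verts \<Gamma>" "?\<beta> x = ?\<beta> y" "x \<noteq> y"
    have "edges \<Gamma> x y \<le> 1"
    proof -
      consider "x \<in> ?V" "y \<in> ?V" | "x \<in> ?V" "y = a \<or> y = b" | "y \<in> ?V" "x = a \<or> x = b"
        | "x = a" "y = b" | "x = b" "y = a"
        using xy unfolding vG by blast
      then show ?thesis
      proof cases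
        case 1
        have "edges \<Gamma>0 x y = 0"
          using E0[of x y] E0[of y x] 1 xy edges_sym[of \<Gamma>0 x y] by (cases "x = v1") auto
        then show ?thesis using E[of x y] good_labellingD(5)[OF g 1 xy(4)] by simp
      next
        case 2
        then show ?thesis using Et(2)[OF 2] by simp
      next
        case 3
        then show ?thesis using Et(2)[OF 3] edges_sym[of \<Gamma> x y] by simp
      next
        case 4
        then show ?thesis using Eab by simp
      next
        case 5
        then show ?thesis using Eab edges_sym[of \<Gamma> x y] by simp
      qed
    qed
    moreover have "?\<beta> x \<bullet> ?\<beta> y = 2" using norm_root[of "?\<beta> x"] roots xy(1,3) by auto
    ultimately show False using edge[OF xy(1,2,4)] by simp
  qed
  \<comment> \<open>The induction descends from the tips, whose roots are simple. The root of the
    chain vertex labelled \<open>i\<close> then yields \<alpha> i after subtracting simple roots of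
    larger index.\<close>
  have span: "\<alpha> i \<in> int_mod.span (?\<beta> ` verts \<Gamma>)" if "i \<in> {1..n}" for i
    using that
  proof (induction "n - i" arbitrary: i rule: less_induct)
    case less
    consider "i \<le> n - 2" | "i = n - 1" | "i = n" using less.prems by fastforce
    then show ?case
    proof cases
      case 1
      then have "i \<in> L ` ?V" using bij less.prems by (simp add: bij_betw_def)
      then obtain x where x: "x \<in> ?V" "L x = i" by auto
      have "?\<beta> x = \<alpha> i + (\<Sum>t = Suc i..<c x. \<alpha> t)"
        using \<beta>V[OF x(1)] cr(1)[OF x(1)] x(2) by (simp add: seg_def sum.atLeast_Suc_lessThan)
      then have "\<alpha> i = ?\<beta> x - (\<Sum>t = Suc i..<c x. \<alpha> t)" by simp
      also have "\<dots> \<in> int_mod.span (?\<beta> ` verts \<Gamma>)"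
      proof (rule int_mod.span_diff[OF int_mod.span_base int_mod.span_sum])
        show "?\<beta> x \<in> ?\<beta> ` verts \<Gamma>" using x(1) unfolding vG by blast
        show "\<alpha> t \<in> int_mod.span (?\<beta> ` verts \<Gamma>)" if "t \<in> {Suc i..<c x}" for t
          using that cr(2)[OF x(1)] less.prems by (intro less.hyps) auto
      qed
      finally show ?thesis .
    next
      case 2
      then obtain t where "t = a \<or> t = b" "L t = i" using Lab by blast
      then show ?thesis using \<beta>o[of t] ab vG by (metis image_eqI insertCI int_mod.span_base)
    next
      case 3
      then obtain t where "t = a \<or> t = b" "L t = i" using Lab by blast
      then show ?thesis using \<beta>o[of t] ab vG by (metis image_eqI insertCI int_mod.span_base)
    qed
  qed
  have "finite (verts \<Gamma>)" "card (verts \<Gamma>) = n"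
    unfolding vG using finV ab cardV assms(1) by auto
  from integral_basis[OF roots injG this span] show ?thesis
    unfolding companion_basis_def using roots injG edge by blast
qed

end
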